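(* For $n\ge5$ let $$\kappa_n=\frac{(n+1)\log\frac{1+\sqrt5}{2}-\log\frac{n+2+\sqrt{n^2+4n}}{2}}{(n-1)\log\sqrt2-\log\frac{n+2+\sqrt{n^2+4n}}{2}+2\log\frac{1+\sqrt5}{2}}.$$ (i) Let $n\ge5$ and let $x\in E_n$ be such that the derivative $?'(x)$ exists and $?'(x)=0$. Then for $t$ large enough one has $$\max_{u\le t}\left(S_x(u)-\kappa_nu\right)\ge\frac{\sqrt t}{160(n+2)^{10}}.$$ (ii) For a given $n\ge5$ there exists $x\in E_n$ such that $?'(x)=0$ and for $t$ large enough one has $$S_x(t)-\kappa_nt\le15n\sqrt t.$$
   Context: The Minkowski question mark function $?:[0,1]\to[0,1]$ is the continuous increasing function defined by $?(0)=0$, $?(1)=1$, by $?\left(\frac{p+p'}{q+q'}\right)=\frac12\left(?\left(\frac pq\right)+?\left(\frac{p'}{q'}\right)\right)$ for consecutive Farey fractions $\frac pq,\frac{p'}{q'}$, and extended by continuity to irrationals. Equivalently, for irrational $x=[0;a_1,a_2,\dots]$, $?(x)=\frac1{2^{a_1-1}}-\frac1{2^{a_1+a_2-1}}+\dots+\frac{(-1)^{n+1}}{2^{a_1+\dots+a_n-1}}+\cdots$. The derivative $?'(x)$ is the two-sided limit of $\frac{?(x+\delta)-?(x)}{\delta}$ as $\delta\to0$. For irrational $x\in(0,1)$ with regular continued fraction expansion $x=[0;a_1,a_2,\dots]$ (natural partial quotients), $S_x(t)=a_1+a_2+\dots+a_t$. For an integer $n\ge2$, $E_n$ is the set of irrational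 $x\in(0,1)$ all of whose partial quotients satisfy $a_j\le n$, $j=1,2,3,\dots$. Here $t,u$ range over natural numbers. *)

theory Defs
  imports "HOL-Analysis.Analysis"
begin

section \<open>Continued fraction expansion of irrationals in the unit interval\<close>

definition gauss_map :: "real \<Rightarrow> real" where
  "gauss_map x = frac (1 / x)"

text \<open>
  For irrational \<open>x\<close> in \<open>(0,1)\<close> and \<open>j \<ge> 1\<close>, \<open>pquot x j\<close> is the \<open>j\<close>-th partial quotient of
  \<open>x = [0; pquot x 1, pquot x 2, \<dots>]\<close>.  The value at \<open>j = 0\<close> is meaningless and never used.
\<close>
definition pquot :: "real \<Rightarrow> nat \<Rightarrow> nat" where
  "pquot x j = nat \<lfloor>1 / (gauss_map ^^ (j - 1)) x\<rfloor>"

definition S :: "real \<Rightarrow> nat \<Rightarrow> nat" where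
  "S x t = (\<Sum>j=1..t. pquot x j)"

definition E :: "nat \<Rightarrow> real set" where
  "E n = {x. 0 < x \<and> x < 1 \<and> x \<notin> \<rat> \<and> (\<forall>j\<ge>1. pquot x j \<le> n)}"

section \<open>The Minkowski question mark function\<close>

text \<open>The pair \<open>(p, q)\<close> stands for the reduced fraction \<open>p / q\<close>.\<close>
definition farey :: "nat \<Rightarrow> (nat \<times> nat) set" where
  "farey m = {(p, q). p \<le> q \<and> 0 < q \<and> q \<le> m \<and> coprime p q}"

definition farey_consecutive :: "nat \<Rightarrow> nat \<Rightarrow> nat \<Rightarrow> nat \<Rightarrow> bool" where
  "farey_consecutive p q p' q' \<longleftrightarrow>
     (\<exists>m. (p, q) \<in> farey m \<and> (p', q') \<in> farey m \<and> real p / real q < real p' / real q' \<and>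
        \<not> (\<exists>(r, s) \<in> farey m. real p / real q < real r / real s \<and>
                            real r / real s < real p' / real q'))"

definition is_question_mark :: "(real \<Rightarrow> real) \<Rightarrow> bool" where
  "is_question_mark f \<longleftrightarrow>
     f ` {0..1} \<subseteq> {0..1} \<and> continuous_on {0..1} f \<and> mono_on {0..1} f \<and> f 0 = 0 \<and> f 1 = 1 \<and>
     (\<forall>p q p' q'. farey_consecutive p q p' q' \<longrightarrow>
        f (real (p + p') / real (q + q')) =
          (f (real p / real q) + f (real p' / real q')) / 2)"

text \<open>
  Outside \<open>[0,1]\<close>, where the function is not defined, the value is fixed to \<open>0\<close>, so that the
  description has exactly one solution; see \<open>question_mark_unique_exists\<close> below.
\<close>
definition question_mark :: "real \<Rightarrow> real" where
  "question_mark = (THE f. is_question_mark f \<and> (\<forall>x. x \<notin> {0..1} \<longrightarrow> f x = 0))"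

section \<open>The constant\<close>

definition kappa :: "nat \<Rightarrow> real" where
  "kappa n =
     ((real n + 1) * ln ((1 + sqrt 5) / 2) - ln ((real n + 2 + sqrt (real n ^ 2 + 4 * real n)) / 2)) /
     ((real n - 1) * ln (sqrt 2) - ln ((real n + 2 + sqrt (real n ^ 2 + 4 * real n)) / 2)
        + 2 * ln ((1 + sqrt 5) / 2))"

section \<open>The question mark function is well defined\<close>

lemma farey_bracket:
  fixes x :: real
  assumes "1 \<le> m" "0 \<le> x" "x < 1"
  shows "\<exists>p q p' q' :: nat. p' * q = p * q' + 1 \<and> 0 < q \<and> q \<le> m \<and> 0 < q' \<and> q' \<le> m \<and>
           m < q + q' \<and> p' \<le> q' \<and> p \<le> q \<and> real p / real q \<le> x \<and> x < real p' / real q'"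
  using assms(1)
proof (induction m rule: dec_induct)
  case base
  show ?case
    by (rule exI[of _ 0], rule exI[of _ 1], rule exI[of _ 1], rule exI[of _ 1]) (use assms in auto)
next
  case (step m)
  then obtain p q p' q' :: nat where h: "p' * q = p * q' + 1" "0 < q" "q \<le> m" "0 < q'" "q' \<le> m"
    "m < q + q'" "p' \<le> q'" "p \<le> q" "real p / real q \<le> x" "x < real p' / real q'" by blast
  consider "Suc m < q + q'" | "q + q' = Suc m" "real (p + p') / real (q + q') \<le> x"
    | "q + q' = Suc m" "x < real (p + p') / real (q + q')"
    using h(6) by linarith
  then show ?case
  proof cases
    case 1
    then show ?thesis using h by (meson le_SucI)
  next
    case 2
    have "p' * (q + q') = (p + p') * q' + 1" using h(1) by (simp add: algebra_simps)
    moreover have "0 < q + q'" "q + q' \<le> Suc m" "q' \<le> Suc m" "Suc m < q + q' + q'"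
      "p + p' \<le> q + q'" using 2 h by linarith+
    ultimately show ?thesis using h(4,7,10) 2(2) by blast
  next
    case 3
    have "(p + p') * q = p * (q + q') + 1" using h(1) by (simp add: algebra_simps)
    moreover have "0 < q + q'" "q + q' \<le> Suc m" "q \<le> Suc m" "Suc m < q + (q + q')"
      "p + p' \<le> q + q'" using 3 h by linarith+
    ultimately show ?thesis using h(2,8,9) 3(2) by blast
  qed
qed

lemma unimodular_coprime:
  fixes p q p' q' :: nat
  assumes "p' * q = p * q' + 1"
  shows "coprime p q" "coprime p' q'"
  using assms
  by (metis coprimeI dvd_add_right_iff dvd_mult dvd_mult2)+

lemma between_unimodular:
  fixes p q p' q' r s :: nat
  assumes u: "p' * q = p * q' + 1" and "0 < q" "0 < q'" "0 < s"
    and "real p / real q < real r / real s" "real r / real s < real p' / real q'"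
  shows "\<exists>i j. 0 < i \<and> 0 < j \<and> s = i * q + j * q' \<and> r = i * p + j * p'"
proof -
  have 1: "p * s < r * q" and 2: "r * q' < p' * s"
    using assms by (simp_all add: field_simps flip: of_nat_mult)
  obtain j where j: "r * q = p * s + j" "0 < j" using 1 less_imp_add_positive by metis
  obtain i where i: "p' * s = r * q' + i" "0 < i" using 2 less_imp_add_positive by metis
  have U: "int p' * int q = int p * int q' + 1" using u by (metis of_nat_1 of_nat_add of_nat_mult)
  have J: "int j = int r * int q - int p * int s"
    using j(1) by (metis add_diff_cancel_left' of_nat_add of_nat_mult)
  have I: "int i = int p' * int s - int r * int q'"
    using i(1) by (metis add_diff_cancel_left' of_nat_add of_nat_mult)
  have s: "int i * int q + int j * int q' = int s" unfolding I J using U by algebra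
  have r: "int i * int p + int j * int p' = int r" unfolding I J using U by algebra
  have "s = i * q + j * q'" "r = i * p + j * p'"
    using s r by (simp_all flip: of_nat_mult of_nat_add)
  with i(2) j(2) show ?thesis by blast
qed

lemma unimodular_imp_less:
  fixes p q p' q' :: nat
  assumes "p' * q = p * q' + 1" "0 < q" "0 < q'"
  shows "real p / real q < real p' / real q'"
proof -
  have "p * q' < p' * q" using assms by simp
  then show ?thesis using assms by (simp add: field_simps flip: of_nat_mult)
qed

lemma unimodular_imp_consecutive:
  fixes p q p' q' :: nat
  assumes "p' * q = p * q' + 1" "0 < q" "0 < q'" "p \<le> q" "p' \<le> q'"
  shows "farey_consecutive p q p' q'"
proof -
  have "\<not> (real p / real q < real r / real s \<and> real r / real s < real p' / real q')"
    if "(r, s) \<in> farey (max q q')" for r s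
  proof
    assume b: "real p / real q < real r / real s \<and> real r / real s < real p' / real q'"
    have s: "0 < s" "s \<le> max q q'" using that by (auto simp: farey_def)
    obtain i j where ij: "0 < i" "0 < j" "s = i * q + j * q'"
      using between_unimodular[OF assms(1-3) s(1) conjunct1[OF b] conjunct2[OF b]] by blast
    have "q \<le> i * q" "q' \<le> j * q'" using ij by simp_all
    then show False using ij(3) s assms(2,3) by linarith
  qed
  then have non: "\<not> (\<exists>(r, s) \<in> farey (max q q'). real p / real q < real r / real s \<and>
      real r / real s < real p' / real q')" by (auto simp del: max.bounded_iff)
  show ?thesis
    unfolding farey_consecutive_def
  proof (intro exI[of _ "max q q'"] conjI)
    show "(p, q) \<in> farey (max q q')" "(p', q') \<in> farey (max q q')"
      using assms unimodular_coprime[OF assms(1)] by (simp_all add: farey_def)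
    show "real p / real q < real p' / real q'" by (rule unimodular_imp_less[OF assms(1-3)])
  qed (rule non)
qed

lemma reduced_fraction_unique:
  fixes a b c d :: nat
  assumes "real a / real b = real c / real d" "coprime a b" "coprime c d" "0 < b" "0 < d"
  shows "a = c" "b = d"
proof -
  have e: "a * d = c * b" using assms by (simp add: field_simps flip: of_nat_mult)
  have "b dvd a * d" "d dvd c * b" using e by (metis dvd_triv_right)+
  then have "b dvd d" "d dvd b" using assms(2,3) by (simp_all add: coprime_dvd_mult_right_iff coprime_commute)
  then show "b = d" by (rule dvd_antisym)
  with e assms(4) show "a = c" by simp
qed

lemma farey_consecutive_iff:
  "farey_consecutive p q p' q' \<longleftrightarrow>
     p' * q = p * q' + 1 \<and> 0 < q \<and> 0 < q' \<and> p \<le> q \<and> p' \<le> q'"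
proof
  assume "farey_consecutive p q p' q'"
  then obtain m where m: "(p, q) \<in> farey m" "(p', q') \<in> farey m"
    and lt: "real p / real q < real p' / real q'"
    and non: "\<And>r s. (r, s) \<in> farey m \<Longrightarrow>
        \<not> (real p / real q < real r / real s \<and> real r / real s < real p' / real q')"
    unfolding farey_consecutive_def by blast
  let ?x = "real p / real q"
  have "real p' / real q' \<le> 1" using m by (auto simp: farey_def)
  with lt have x: "0 \<le> ?x" "?x < 1" by auto
  have "1 \<le> m" using m by (auto simp: farey_def)
  from farey_bracket[OF this x] obtain a b a' b' :: nat where
    h: "a' * b = a * b' + 1" "0 < b" "b \<le> m" "0 < b'" "b' \<le> m" "m < b + b'" "a' \<le> b'" "a \<le> b"
       "real a / real b \<le> ?x" "?x < real a' / real b'" by blast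
  have gap: "\<not> (real a / real b < real r / real s \<and> real r / real s < real a' / real b')"
    if rs: "(r, s) \<in> farey m" for r s
  proof
    assume c: "real a / real b < real r / real s \<and> real r / real s < real a' / real b'"
    have s: "0 < s" "s \<le> m" using rs by (auto simp: farey_def)
    obtain i j where ij: "0 < i" "0 < j" "s = i * b + j * b'"
      using between_unimodular[OF h(1,2,4) s(1) conjunct1[OF c] conjunct2[OF c]] by blast
    have "b \<le> i * b" "b' \<le> j * b'" using ij by simp_all
    then show False using ij(3) s h(6) by linarith
  qed
  have e1: "?x = real a / real b" using gap[OF m(1)] h(9,10) by linarith
  have "(a', b') \<in> farey m" using h unimodular_coprime[OF h(1)] by (auto simp: farey_def)
  then have "\<not> real a' / real b' < real p' / real q'" using non h(10) by blast
  moreover have "\<not> real p' / real q' < real a' / real b'" using gap[OF m(2)] lt e1 by auto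
  ultimately have e2: "real p' / real q' = real a' / real b'" by linarith
  have pq: "coprime p q" "0 < q" "coprime p' q'" "0 < q'" using m by (auto simp: farey_def)
  note cop = unimodular_coprime[OF h(1)]
  have "p = a" "q = b" "p' = a'" "q' = b'"
    using reduced_fraction_unique[OF e1 pq(1) cop(1) pq(2) h(2)]
      reduced_fraction_unique[OF e2 pq(3) cop(2) pq(4) h(4)] by simp_all
  then show "p' * q = p * q' + 1 \<and> 0 < q \<and> 0 < q' \<and> p \<le> q \<and> p' \<le> q'" using h by blast
qed (simp add: unimodular_imp_consecutive)

lemma question_mark_agree_rational:
  fixes r s :: nat
  assumes f: "is_question_mark f" and g: "is_question_mark g"
  shows "\<lbrakk>0 < s; r \<le> s; coprime r s\<rbrakk> \<Longrightarrow> f (real r / real s) = g (real r / real s)"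
proof (induction s arbitrary: r rule: less_induct)
  case (less s)
  show ?case
  proof (cases "s = 1")
    case True
    then have "r = 0 \<or> r = 1" using less.prems by linarith
    then show ?thesis using True f g by (auto simp: is_question_mark_def)
  next
    case False
    then have s2: "2 \<le> s" using less.prems by simp
    have "r \<noteq> s" using less.prems s2 by auto
    with less.prems have x: "0 \<le> real r / real s" "real r / real s < 1" by auto
    have "1 \<le> s - 1" using s2 by simp
    from farey_bracket[OF this x] obtain p q p' q' :: nat where
      h: "p' * q = p * q' + 1" "0 < q" "q \<le> s - 1" "0 < q'" "q' \<le> s - 1" "s - 1 < q + q'"
         "p' \<le> q'" "p \<le> q" "real p / real q \<le> real r / real s"
         "real r / real s < real p' / real q'" by blast
    note cop = unimodular_coprime[OF h(1)]
    have "real p / real q \<noteq> real r / real s"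
      using reduced_fraction_unique(2)[of p q r s] cop less.prems h s2 by auto
    with h(9) have "real p / real q < real r / real s" by simp
    from between_unimodular[OF h(1,2,4) _ this h(10)] less.prems obtain i j where
      ij: "0 < i" "0 < j" "s = i * q + j * q'" "r = i * p + j * p'" by blast
    have "i = 1 \<and> j = 1"
    proof (rule ccontr)
      assume "\<not> (i = 1 \<and> j = 1)"
      with ij have "(2 \<le> i \<and> 1 \<le> j) \<or> (1 \<le> i \<and> 2 \<le> j)" by auto
      then show False
      proof
        assume "2 \<le> i \<and> 1 \<le> j"
        then have "2 * q \<le> i * q" "1 * q' \<le> j * q'" by (meson mult_le_mono1)+
        then show False using ij(3) h(2,6) by linarith
      next
        assume "1 \<le> i \<and> 2 \<le> j"
        then have "1 * q \<le> i * q" "2 * q' \<le> j * q'" by (meson mult_le_mono1)+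
        then show False using ij(3) h(4,6) by linarith
      qed
    qed
    then have rs: "r = p + p'" "s = q + q'" using ij by auto
    have "f (real p / real q) = g (real p / real q)" "f (real p' / real q') = g (real p' / real q')"
      using less.IH[of q p] less.IH[of q' p'] h cop s2 by auto
    moreover have "farey_consecutive p q p' q'" using h unimodular_imp_consecutive by blast
    ultimately show ?thesis unfolding rs using f g unfolding is_question_mark_def by metis
  qed
qed

definition qm_step :: "(real \<Rightarrow> real) \<Rightarrow> real \<Rightarrow> real" where
  "qm_step g x = (if x \<le> 1/2 then g (x / (1 - x)) / 2 else 1 - g ((1 - x) / x) / 2)"

definition qm_admissible :: "(real \<Rightarrow> real) \<Rightarrow> bool" where
  "qm_admissible g \<longleftrightarrow> continuous_on {0..1} g \<and> mono_on {0..1} g \<and> g 0 = 0 \<and> g 1 = 1"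

lemma qm_step_args:
  fixes x :: real
  shows "0 \<le> x \<Longrightarrow> x \<le> 1/2 \<Longrightarrow> x / (1 - x) \<in> {0..1}"
    and "1/2 \<le> x \<Longrightarrow> x \<le> 1 \<Longrightarrow> (1 - x) / x \<in> {0..1}"
  by (auto simp: divide_simps)

lemma qm_step_admissible:
  assumes "qm_admissible g"
  shows "qm_admissible (qm_step g)"
proof -
  have c: "continuous_on {0..1} g" and m: "mono_on {0..1} g" and g0: "g 0 = 0" and g1: "g 1 = 1"
    using assms by (auto simp: qm_admissible_def)
  have bnd: "0 \<le> g y" "g y \<le> 1" if "y \<in> {0..1}" for y
    using mono_onD[OF m, of 0 y] mono_onD[OF m, of y 1] that g0 g1 by auto
  have c1: "continuous_on {0..1/2} (\<lambda>x. g (x / (1 - x)) / 2)"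
    by (intro continuous_intros continuous_on_compose2[OF c]) (use qm_step_args(1) in auto)
  have c2: "continuous_on {1/2..1} (\<lambda>x. 1 - g ((1 - x) / x) / 2)"
    by (intro continuous_intros continuous_on_compose2[OF c]) (use qm_step_args(2) in auto)
  have "continuous_on ({0..1/2} \<union> {1/2..1}) (qm_step g)"
    unfolding qm_step_def
  proof (rule continuous_on_cases[OF _ _ c1 c2])
    show "\<forall>x. x \<in> {0..1/2} \<and> \<not> x \<le> 1/2 \<or> x \<in> {1/2..1} \<and> x \<le> 1/2 \<longrightarrow>
        g (x / (1 - x)) / 2 = 1 - g ((1 - x) / x) / 2"
    proof (intro allI impI)
      fix x :: real
      assume "x \<in> {0..1/2} \<and> \<not> x \<le> 1/2 \<or> x \<in> {1/2..1} \<and> x \<le> 1/2"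
      then have "x = 1/2" by auto
      then have e: "x / (1 - x) = 1" "(1 - x) / x = 1" by simp_all
      show "g (x / (1 - x)) / 2 = 1 - g ((1 - x) / x) / 2" unfolding e g1 by simp
    qed
  qed auto
  moreover have "{0..1/2} \<union> {1/2..1} = {0..1::real}" by auto
  moreover have "mono_on {0..1} (qm_step g)"
  proof (rule mono_onI)
    fix x y :: real
    assume xy: "x \<in> {0..1}" "y \<in> {0..1}" "x \<le> y"
    consider "y \<le> 1/2" | "x \<le> 1/2" "1/2 < y" | "1/2 < x" using xy by linarith
    then show "qm_step g x \<le> qm_step g y"
    proof cases
      case 1
      have "x / (1 - x) \<le> y / (1 - y)" using 1 xy by (auto simp: divide_simps algebra_simps)
      then have "g (x / (1 - x)) \<le> g (y / (1 - y))"
        using mono_onD[OF m qm_step_args(1) qm_step_args(1)] 1 xy by auto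
      then show ?thesis using 1 xy by (simp add: qm_step_def)
    next
      case 2
      then have "g (x / (1 - x)) \<le> 1" "g ((1 - y) / y) \<le> 1"
        using bnd qm_step_args xy by auto
      then show ?thesis using 2 by (simp add: qm_step_def)
    next
      case 3
      have "(1 - y) / y \<le> (1 - x) / x" using 3 xy by (auto simp: divide_simps algebra_simps)
      then have "g ((1 - y) / y) \<le> g ((1 - x) / x)"
        using mono_onD[OF m qm_step_args(2) qm_step_args(2)] 3 xy by auto
      then show ?thesis using 3 xy by (simp add: qm_step_def)
    qed
  qed
  ultimately show ?thesis by (simp add: qm_admissible_def qm_step_def g0)
qed

definition qm_iter :: "nat \<Rightarrow> real \<Rightarrow> real" where
  "qm_iter n = (qm_step ^^ n) (\<lambda>x. x)"

lemma qm_iter_Suc: "qm_iter (Suc n) = qm_step (qm_iter n)"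
  by (simp add: qm_iter_def)

lemma qm_iter_admissible: "qm_admissible (qm_iter n)"
  by (induction n)
    (auto simp: qm_iter_Suc qm_step_admissible, auto simp: qm_iter_def qm_admissible_def mono_on_def)

lemma qm_iter_diff: "x \<in> {0..1} \<Longrightarrow> \<bar>qm_iter (Suc n) x - qm_iter n x\<bar> \<le> (1/2) ^ n"
proof (induction n arbitrary: x)
  case 0
  have "qm_step (\<lambda>x. x) x \<in> {0..1}" using 0 by (auto simp: qm_step_def divide_simps)
  then show ?case using 0 by (auto simp: qm_iter_def)
next
  case (Suc n)
  have half: "\<bar>a / 2 - b / 2\<bar> = \<bar>a - b\<bar> / 2" "\<bar>(1 - a / 2) - (1 - b / 2)\<bar> = \<bar>a - b\<bar> / 2"
    for a b :: real by (simp_all add: abs_if)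
  obtain y where y: "y \<in> {0..1}"
    "\<bar>qm_step (qm_iter (Suc n)) x - qm_step (qm_iter n) x\<bar> = \<bar>qm_iter (Suc n) y - qm_iter n y\<bar> / 2"
  proof (cases "x \<le> 1/2")
    case True
    show ?thesis
      by (rule that[OF qm_step_args(1)[of x]]) (use True Suc.prems half(1) in \<open>simp_all add: qm_step_def\<close>)
  next
    case False
    show ?thesis
      by (rule that[OF qm_step_args(2)[of x]]) (use False Suc.prems half(2) in \<open>simp_all add: qm_step_def\<close>)
  qed
  then show ?case
    using Suc.IH[OF y(1)] by (simp add: qm_iter_Suc[of "Suc n"] qm_iter_Suc[of n, symmetric])
qed

lemma qm_fixpoint_exists: "\<exists>f. qm_admissible f \<and> (\<forall>x\<in>{0..1}. f x = qm_step f x)"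
proof -
  let ?d = "\<lambda>n x. qm_iter (Suc n) x - qm_iter n x"
  define f where "f x = (\<Sum>n. ?d n x) + x" for x
  have "uniform_limit {0..1} (\<lambda>n x. \<Sum>i<n. ?d i x) (\<lambda>x. \<Sum>n. ?d n x) sequentially"
    by (rule Weierstrass_m_test[where M = "\<lambda>n. (1/2) ^ n"])
      (use qm_iter_diff in \<open>auto intro: summable_geometric\<close>)
  then have "uniform_limit {0..1} (\<lambda>n x. (\<Sum>i<n. ?d i x) + x) f sequentially"
    unfolding f_def by (intro uniform_limit_intros)
  moreover have "(\<Sum>i<n. ?d i x) + x = qm_iter n x" for n x
    by (subst sum_lessThan_telescope) (simp add: qm_iter_def)
  ultimately have ul: "uniform_limit {0..1} qm_iter f sequentially" by simp
  have lim: "(\<lambda>n. qm_iter n x) \<longlonglongrightarrow> f x" if "x \<in> {0..1}" for x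
    using tendsto_uniform_limitI[OF ul that] .
  have adm: "continuous_on {0..1} (qm_iter n)" "mono_on {0..1} (qm_iter n)"
    "qm_iter n 0 = 0" "qm_iter n 1 = 1" for n
    using qm_iter_admissible[of n] by (auto simp: qm_admissible_def)
  have "continuous_on {0..1} f"
    by (rule uniform_limit_theorem[OF _ ul]) (use adm in auto)
  moreover have "mono_on {0..1} f"
  proof (rule mono_onI)
    fix x y :: real
    assume "x \<in> {0..1}" "y \<in> {0..1}" "x \<le> y"
    then show "f x \<le> f y"
      using LIMSEQ_le[OF lim lim, of x y] mono_onD[OF adm(2)] by blast
  qed
  moreover have "f 0 = 0" "f 1 = 1"
    using lim[of 0] lim[of 1] adm(3,4) by (simp_all add: LIMSEQ_const_iff)
  moreover have "f x = qm_step f x" if x: "x \<in> {0..1}" for x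
  proof -
    have "(\<lambda>n. qm_iter (Suc n) x) \<longlonglongrightarrow> qm_step f x"
    proof (cases "x \<le> 1/2")
      case True
      then show ?thesis
        unfolding qm_iter_Suc using lim[OF qm_step_args(1)[of x]] x
        by (simp add: qm_step_def tendsto_divide)
    next
      case False
      then have "(\<lambda>n. 1 - qm_iter n ((1 - x) / x) / 2) \<longlonglongrightarrow> 1 - f ((1 - x) / x) / 2"
        using lim[OF qm_step_args(2)[of x]] x by (intro tendsto_intros) auto
      with False show ?thesis unfolding qm_iter_Suc by (simp add: qm_step_def)
    qed
    moreover have "(\<lambda>n. qm_iter (Suc n) x) \<longlonglongrightarrow> f x" using lim[OF x] by (rule LIMSEQ_Suc)
    ultimately show ?thesis using LIMSEQ_unique by blast
  qed
  ultimately show ?thesis by (auto simp: qm_admissible_def)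
qed

lemma qm_fixpoint_mediant:
  assumes adm: "qm_admissible f" and fp: "\<And>x. x \<in> {0..1} \<Longrightarrow> f x = qm_step f x"
  shows "\<lbrakk>p' * q = p * q' + 1; 0 < q; 0 < q'; p \<le> q; p' \<le> q'\<rbrakk> \<Longrightarrow>
    f (real (p + p') / real (q + q')) = (f (real p / real q) + f (real p' / real q')) / 2"
proof (induction "q + q'" arbitrary: p q p' q' rule: less_induct)
  case less
  have f01: "f 0 = 0" "f 1 = 1" using adm by (auto simp: qm_admissible_def)
  have lo: "f (real a / real b) = f (real a / real (b - a)) / 2" if "2 * a \<le> b" "0 < b" for a b :: nat
  proof -
    have mem: "real a / real b \<in> {0..1}" and le: "real a / real b \<le> 1/2"
      using that by (simp_all add: field_simps)
    have e: "(real a / real b) / (1 - real a / real b) = real a / real (b - a)"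
    proof -
      have "1 - real a / real b = real (b - a) / real b"
        using that by (simp add: of_nat_diff diff_divide_distrib)
      then show ?thesis using that by simp
    qed
    show ?thesis using fp[OF mem] unfolding qm_step_def e if_P[OF le] .
  qed
  have hi: "f (real a / real b) = 1 - f (real (b - a) / real a) / 2"
    if "b \<le> 2 * a" "a \<le> b" "0 < b" for a b :: nat
  proof (cases "b = 2 * a")
    case True
    then show ?thesis using lo[of a b] that f01 by simp
  next
    case False
    then have mem: "real a / real b \<in> {0..1}" and nle: "\<not> real a / real b \<le> 1/2"
      using that by (simp_all add: field_simps)
    have e: "(1 - real a / real b) / (real a / real b) = real (b - a) / real a"
    proof -
      have "1 - real a / real b = real (b - a) / real b"
        using that by (simp add: of_nat_diff diff_divide_distrib)
      then show ?thesis using that by simp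
    qed
    show ?thesis using fp[OF mem] unfolding qm_step_def e if_not_P[OF nle] .
  qed
  have p': "0 < p'" using less.prems by (cases p') auto
  have "p * q' < p' * q" using less.prems by simp
  consider "2 * p' \<le> q'" | "q \<le> 2 * p" | "q' < 2 * p'" "2 * p < q" by linarith
  then show ?case
  proof cases
    case 1
    have "2 * p * q' < q * q'"
    proof -
      have "2 * (p * q') < 2 * (p' * q)" using less.prems by simp
      also have "\<dots> = (2 * p') * q" by simp
      also have "\<dots> \<le> q' * q" using 1 by (rule mult_le_mono1)
      finally show ?thesis by (simp add: mult.commute mult.left_commute)
    qed
    then have pq: "2 * p < q" by simp
    have "p' * (q - p) = p * (q' - p') + 1"
    proof -
      have "p * p' \<le> p * q'" using less.prems by simp
      moreover have "p' * (q - p) = p * q' + 1 - p * p'" using less.prems(1)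
        by (simp add: diff_mult_distrib2 mult.commute)
      ultimately show ?thesis unfolding diff_mult_distrib2[of p] by linarith
    qed
    then have "f (real (p + p') / real ((q - p) + (q' - p'))) =
        (f (real p / real (q - p)) + f (real p' / real (q' - p'))) / 2"
      using p' pq 1 by (intro less.hyps) auto
    moreover have "(q - p) + (q' - p') = (q + q') - (p + p')" using pq 1 by simp
    ultimately show ?thesis
      using lo[of p q] lo[of p' q'] lo[of "p + p'" "q + q'"] pq 1 less.prems by simp
  next
    case 2
    have "q * q' < 2 * p' * q"
    proof -
      have "q * q' \<le> (2 * p) * q'" using 2 by (rule mult_le_mono1)
      also have "\<dots> < 2 * (p' * q)" using less.prems by simp
      finally show ?thesis by (simp add: mult.commute mult.left_commute)
    qed
    then have pq': "q' < 2 * p'" by (simp add: mult.commute)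
    have "p < q"
    proof (rule ccontr)
      assume "\<not> p < q"
      then have "p = q" using less.prems by simp
      with less.prems have "q * p' = q * q' + 1" by (simp add: mult.commute)
      moreover have "q * p' \<le> q * q'" using less.prems by simp
      ultimately show False by simp
    qed
    have "(q - p) * p' = (q' - p') * p + 1"
    proof -
      have "p * p' \<le> p * q'" using less.prems by simp
      moreover have "(q - p) * p' = p * q' + 1 - p * p'"
        using less.prems(1) by (metis diff_mult_distrib mult.commute)
      ultimately show ?thesis unfolding mult.commute[of _ p] diff_mult_distrib2[of p] by linarith
    qed
    then have "f (real ((q' - p') + (q - p)) / real (p' + p)) =
        (f (real (q' - p') / real p') + f (real (q - p) / real p)) / 2"
      using p' pq' 2 \<open>p < q\<close> less.prems by (intro less.hyps) auto
    moreover have "(q' - p') + (q - p) = (q + q') - (p + p')" "p' + p = p + p'"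
      using less.prems by simp_all
    ultimately have A: "f (real ((q + q') - (p + p')) / real (p + p')) =
        (f (real (q' - p') / real p') + f (real (q - p) / real p)) / 2" by metis
    have le: "q + q' \<le> 2 * (p + p')" "p + p' \<le> q + q'" "0 < q + q'"
      using pq' 2 less.prems(2-) by auto
    have B: "f (real p / real q) = 1 - f (real (q - p) / real p) / 2"
      "f (real p' / real q') = 1 - f (real (q' - p') / real p') / 2"
      by (rule hi; use pq' 2 less.prems in linarith)+
    note B = B hi[OF le]
    show ?thesis unfolding B A by (simp add: field_simps)
  next
    case 3
    have "(q' + 1) * q \<le> (2 * p') * q" using 3 by (intro mult_le_mono1) simp
    also have "\<dots> = (2 * p) * q' + 2" using less.prems(1) by simp
    finally have a: "q' * q + q \<le> (2 * p) * q' + 2" by simp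
    have "(2 * p + 1) * q' \<le> q * q'" using 3 by (intro mult_le_mono1) simp
    then have "(2 * p) * q' + q' \<le> q' * q" by (simp add: mult.commute)
    with a have "q + q' \<le> 2" by linarith
    with less.prems have "q = 1" "q' = 1" by auto
    with 3 less.prems have "p = 0" "p' = 1" by auto
    then show ?thesis using \<open>q = 1\<close> \<open>q' = 1\<close> lo[of 1 2] f01 by simp
  qed
qed

lemma question_mark_unique_exists:
  "\<exists>!f. is_question_mark f \<and> (\<forall>x. x \<notin> {0..1} \<longrightarrow> f x = 0)"
proof (rule ex_ex1I)
  obtain f where adm: "qm_admissible f" and fp: "\<And>x. x \<in> {0..1} \<Longrightarrow> f x = qm_step f x"
    using qm_fixpoint_exists by blast
  define g where "g x = (if x \<in> {0..1} then f x else 0)" for x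
  have fg: "g x = f x" if "x \<in> {0..1}" for x using that by (simp add: g_def)
  have c: "continuous_on {0..1} g" using adm continuous_on_cong[of "{0..1}" "{0..1}" g f] fg
    by (auto simp: qm_admissible_def)
  have m: "mono_on {0..1} g" using adm fg by (simp add: qm_admissible_def mono_on_def)
  have g01: "g 0 = 0" "g 1 = 1" using adm by (simp_all add: qm_admissible_def g_def)
  have "g ` {0..1} \<subseteq> {0..1}"
    using mono_onD[OF m, of 0] mono_onD[OF m, of _ 1] g01 by fastforce
  moreover have "g (real (p + p') / real (q + q')) = (g (real p / real q) + g (real p' / real q')) / 2"
    if "farey_consecutive p q p' q'" for p q p' q'
  proof -
    have h: "p' * q = p * q' + 1" "0 < q" "0 < q'" "p \<le> q" "p' \<le> q'"
      using that by (auto simp: farey_consecutive_iff)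
    have "real (p + p') / real (q + q') \<in> {0..1}" "real p / real q \<in> {0..1}"
      "real p' / real q' \<in> {0..1}" using h by auto
    then show ?thesis using qm_fixpoint_mediant[OF adm fp h] fg by metis
  qed
  ultimately have "is_question_mark g" unfolding is_question_mark_def using c m g01 by blast
  then show "\<exists>f. is_question_mark f \<and> (\<forall>x. x \<notin> {0..1} \<longrightarrow> f x = 0)" by (auto simp: g_def)
next
  fix f g
  assume f: "is_question_mark f \<and> (\<forall>x. x \<notin> {0..1} \<longrightarrow> f x = 0)"
    and g: "is_question_mark g \<and> (\<forall>x. x \<notin> {0..1} \<longrightarrow> g x = 0)"
  have "f x = g x" if x: "x \<in> {0..1}" for x
  proof -
    have cf: "continuous_on {0..1} f" and cg: "continuous_on {0..1} g"
      using f g by (auto simp: is_question_mark_def)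
    define r where "r n = nat \<lfloor>x * real (Suc n)\<rfloor>" for n
    have rn: "real (r n) \<le> x * real (Suc n)" "x * real (Suc n) - 1 \<le> real (r n)" for n
    proof -
      have "0 \<le> x * real (Suc n)" using x by simp
      then show "real (r n) \<le> x * real (Suc n)" "x * real (Suc n) - 1 \<le> real (r n)"
        unfolding r_def by (simp_all add: of_nat_nat)
    qed
    have le: "r n \<le> Suc n" for n
    proof -
      have "real (r n) \<le> 1 * real (Suc n)"
        by (rule order_trans[OF rn(1) mult_right_mono]) (use x in auto)
      then show ?thesis by simp
    qed
    have lim: "(\<lambda>n. real (r n) / real (Suc n)) \<longlonglongrightarrow> x"
    proof (rule tendsto_sandwich)
      show "\<forall>\<^sub>F n in sequentially. x - 1 / real (Suc n) \<le> real (r n) / real (Suc n)"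
      proof (intro always_eventually allI)
        fix n
        have "x - 1 / real (Suc n) = (x * real (Suc n) - 1) / real (Suc n)"
          by (simp add: diff_divide_distrib del: of_nat_Suc)
        also have "\<dots> \<le> real (r n) / real (Suc n)" by (rule divide_right_mono[OF rn(2)]) simp
        finally show "x - 1 / real (Suc n) \<le> real (r n) / real (Suc n)" .
      qed
      show "\<forall>\<^sub>F n in sequentially. real (r n) / real (Suc n) \<le> x"
        using rn(1) by (intro always_eventually) (simp add: pos_divide_le_eq del: of_nat_Suc)
      show "(\<lambda>n. x - 1 / real (Suc n)) \<longlonglongrightarrow> x"
        using tendsto_diff[OF tendsto_const LIMSEQ_inverse_real_of_nat, of x] by (simp add: inverse_eq_divide)
    qed simp
    have mem: "real (r n) / real (Suc n) \<in> {0..1}" for n using le[of n] by simp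
    have eq: "f (real (r n) / real (Suc n)) = g (real (r n) / real (Suc n))" for n
    proof -
      let ?d = "gcd (r n) (Suc n)"
      obtain a b where ab: "r n = a * ?d" "Suc n = b * ?d" "coprime a b"
        by (metis gcd_coprime_exists gcd_eq_0_iff nat.distinct(1))
      have d: "0 < ?d" by simp
      have "0 < b" using ab(2) by (cases b) auto
      moreover have "a \<le> b" using le[of n] ab(1,2) d by (metis mult_le_cancel2)
      moreover have "real (r n) / real (Suc n) = real a / real b"
        using d by (subst ab(1), subst ab(2)) (simp del: of_nat_Suc)
      ultimately show ?thesis using question_mark_agree_rational[of f g b a] f g ab(3) by simp
    qed
    have "(\<lambda>n. f (real (r n) / real (Suc n))) \<longlonglongrightarrow> f x"
      by (rule continuous_on_tendsto_compose[OF cf lim x]) (use mem in auto)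
    moreover have "(\<lambda>n. f (real (r n) / real (Suc n))) \<longlonglongrightarrow> g x"
      unfolding eq by (rule continuous_on_tendsto_compose[OF cg lim x]) (use mem in auto)
    ultimately show ?thesis by (rule LIMSEQ_unique)
  qed
  with f g show "f = g" by (metis ext)
qed

lemma question_mark_is_question_mark: "is_question_mark question_mark"
  unfolding question_mark_def using theI'[OF question_mark_unique_exists] by blast

end

theory Submission
  imports Defs
begin

text \<open>
  If the partial quotients of \<open>x\<close> are bounded, then \<open>?'(x) = 0\<close> holds if and only if
  \<open>q\<^sub>t\<^sup>2 / 2\<^bsup>S\<^sub>x(t)\<^esup>\<close> tends to \<open>0\<close>: the cylinder of order \<open>t\<close> around \<open>x\<close> has length about
  \<open>q\<^sub>t\<^sup>-\<^sup>2\<close> and its image has length \<open>2\<^bsup>-S\<^sub>x(t)\<^esup>\<close>. So the problem is to minimise the continuant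
  \<open>q\<^sub>t\<close> when the digits are at most \<open>n\<close> and their sum is given.

  The constant \<open>kappa n\<close> is the average digit at which mixtures of the two regimes \<open>1, 1, 1, \<dots>\<close> and
  \<open>1, n, 1, n, \<dots>\<close> are critical. A potential, the minimum of three linear forms in \<open>q\<^sub>t\<close> and
  \<open>q\<^sub>t\<^sub>-\<^sub>1\<close>, shows that nothing beats these mixtures: each digit multiplies it at least by a
  weight that is log-affine in the digit, and by a definite factor more at any step that does not
  continue one of the two regimes. Hence \<open>S\<^sub>x(t) - kappa n * t\<close> bounds the number of such defects up
  to \<open>t\<close>. If it stays below \<open>M\<close>, there are \<open>O(M)\<close> defects; but between two defects it drifts at a
  linear rate, so they are at distance \<open>O(M)\<close>, and \<open>t = O(M\<^sup>2)\<close>. Conversely, alternating the two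
  regimes in blocks of linearly growing length attains the order \<open>\<surd>t\<close>.
\<close>

section \<open>Minkowski's function on cylinders\<close>

text \<open>The fixed point of \<open>qm_step\<close>, extended by 0, has all the defining
  properties, so uniqueness identifies it with \<open>question_mark\<close>, which inherits the
  functional equation.\<close>

lemma question_mark_qm_step:
  assumes x: "x \<in> {0..1}"
  shows "question_mark x = qm_step question_mark x"
proof -
  obtain f where adm: "qm_admissible f" and fp: "\<And>x. x \<in> {0..1} \<Longrightarrow> f x = qm_step f x"
    using qm_fixpoint_exists by blast
  define g where "g x = (if x \<in> {0..1} then f x else 0)" for x
  have fg: "g x = f x" if "x \<in> {0..1}" for x using that by (simp add: g_def)
  have c: "continuous_on {0..1} g" using adm continuous_on_cong[of "{0..1}" "{0..1}" g f] fg
    by (auto simp: qm_admissible_def)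
  have m: "mono_on {0..1} g" using adm fg by (simp add: qm_admissible_def mono_on_def)
  have g01: "g 0 = 0" "g 1 = 1" using adm by (simp_all add: qm_admissible_def g_def)
  have "g ` {0..1} \<subseteq> {0..1}"
    using mono_onD[OF m, of 0] mono_onD[OF m, of _ 1] g01 by fastforce
  moreover have "g (real (p + p') / real (q + q')) = (g (real p / real q) + g (real p' / real q')) / 2"
    if "farey_consecutive p q p' q'" for p q p' q'
  proof -
    have h: "p' * q = p * q' + 1" "0 < q" "0 < q'" "p \<le> q" "p' \<le> q'"
      using that by (auto simp: farey_consecutive_iff)
    have "real (p + p') / real (q + q') \<in> {0..1}" "real p / real q \<in> {0..1}"
      "real p' / real q' \<in> {0..1}" using h by auto
    then show ?thesis using qm_fixpoint_mediant[OF adm fp h] fg by metis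
  qed
  ultimately have "is_question_mark g \<and> (\<forall>x. x \<notin> {0..1} \<longrightarrow> g x = 0)"
    unfolding is_question_mark_def using c m g01 by (auto simp: g_def)
  then have "question_mark = g"
    unfolding question_mark_def by (rule the1_equality[OF question_mark_unique_exists])
  moreover have "qm_step g x = qm_step f x"
    unfolding qm_step_def using x qm_step_args[of x] fg by auto
  ultimately show ?thesis using fp[OF x] fg[OF x] by simp
qed

lemma question_mark_simps [simp]: "question_mark 0 = 0" "question_mark 1 = 1"
  using question_mark_is_question_mark by (auto simp: is_question_mark_def)

lemma question_mark_mono: "0 \<le> x \<Longrightarrow> x \<le> y \<Longrightarrow> y \<le> 1 \<Longrightarrow> question_mark x \<le> question_mark y"
  using question_mark_is_question_mark by (auto simp: is_question_mark_def mono_on_def)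

lemma question_mark_nonneg: "0 \<le> x \<Longrightarrow> x \<le> 1 \<Longrightarrow> 0 \<le> question_mark x"
  using question_mark_mono[of 0 x] by simp

lemma question_mark_le_1: "0 \<le> x \<Longrightarrow> x \<le> 1 \<Longrightarrow> question_mark x \<le> 1"
  using question_mark_mono[of x 1] by simp

text \<open>The case \<open>a = 0\<close> is the upper branch of \<open>qm_step\<close> (or the
  boundary point 1/2, if \<open>y = 1\<close>); every further unit is one use of
  \<open>x / (1 - x)\<close>, which halves the value.\<close>

lemma question_mark_inverse_add:
  assumes y: "0 \<le> y" "y \<le> 1"
  shows "question_mark (1 / (real (Suc a) + y)) = (1 - question_mark y / 2) / 2 ^ a"
proof (induction a)
  case 0
  have mem: "1 / (1 + y) \<in> {0..1}" using y by simp
  show ?case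
  proof (cases "y = 1")
    case True
    then show ?thesis using question_mark_qm_step[OF mem] by (simp add: qm_step_def)
  next
    case False
    have "\<not> 1 / (1 + y) \<le> 1 / 2" using False y by (simp add: field_simps)
    moreover have "(1 - 1 / (1 + y)) / (1 / (1 + y)) = y" using y by (simp add: field_simps)
    ultimately show ?thesis using question_mark_qm_step[OF mem] by (simp add: qm_step_def)
  qed
next
  case (Suc a)
  let ?x = "1 / (real (Suc (Suc a)) + y)"
  have mem: "?x \<in> {0..1}" and le: "?x \<le> 1 / 2" using y by (simp_all add: field_simps)
  have "?x / (1 - ?x) = 1 / (real (Suc a) + y)" using y by (simp add: divide_simps)
  then show ?case using question_mark_qm_step[OF mem] le Suc by (simp add: qm_step_def)
qed

text \<open>
  \<open>past a t\<close> is the reversed fraction \<open>[0; a t, \<dots>, a 1]\<close>, that is the quotient of the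
  denominators of the convergents of index \<open>t - 1\<close> and \<open>t\<close>; \<open>den a t\<close> is the latter denominator.
\<close>
primrec past :: "(nat \<Rightarrow> nat) \<Rightarrow> nat \<Rightarrow> real" where
  "past a 0 = 0"
| "past a (Suc t) = 1 / (real (a (Suc t)) + past a t)"

primrec den :: "(nat \<Rightarrow> nat) \<Rightarrow> nat \<Rightarrow> real" where
  "den a 0 = 1"
| "den a (Suc t) = (real (a (Suc t)) + past a t) * den a t"

text \<open>The number \<open>[0; a 1, ..., a t + y]\<close>. As \<open>y\<close> runs through
  \<open>[0, 1]\<close> it sweeps out the cylinder of order \<open>t\<close>; a further digit only
  changes the argument.\<close>

primrec cyl :: "(nat \<Rightarrow> nat) \<Rightarrow> nat \<Rightarrow> real \<Rightarrow> real" where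
  "cyl a 0 y = y"
| "cyl a (Suc t) y = cyl a t (1 / (real (a (Suc t)) + y))"

definition digits :: "(nat \<Rightarrow> nat) \<Rightarrow> nat \<Rightarrow> bool" where
  "digits a n \<longleftrightarrow> (\<forall>j\<ge>1. 1 \<le> a j \<and> a j \<le> n)"

definition digsum :: "(nat \<Rightarrow> nat) \<Rightarrow> nat \<Rightarrow> nat" where
  "digsum a t = (\<Sum>j=1..t. a j)"

lemma digsum_simps [simp]: "digsum a 0 = 0" "digsum a (Suc t) = digsum a t + a (Suc t)"
  by (simp_all add: digsum_def)

lemma digitsD: "digits a n \<Longrightarrow> 1 \<le> a (Suc t)" "digits a n \<Longrightarrow> a (Suc t) \<le> n"
  "digits a n \<Longrightarrow> 1 \<le> real (a (Suc t))" "digits a n \<Longrightarrow> real (a (Suc t)) \<le> real n"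
  by (auto simp: digits_def)

lemma past_bounds:
  assumes "digits a n"
  shows "0 \<le> past a t" "past a t \<le> 1"
proof -
  have "0 \<le> past a t \<and> past a t \<le> 1"
  proof (induction t)
    case (Suc t)
    then show ?case using digitsD(3)[OF assms, of t] by (simp add: divide_simps)
  qed simp
  then show "0 \<le> past a t" "past a t \<le> 1" by auto
qed

lemma den_mono_step:
  assumes "digits a n"
  shows "den a t \<ge> 1" "den a t \<le> den a (Suc t)"
proof -
  have st: "1 \<le> real (a (Suc t)) + past a t" for t
    using digitsD(3)[OF assms, of t] past_bounds(1)[OF assms, of t] by linarith
  show 1: "den a t \<ge> 1" for t
  proof (induction t)
    case (Suc t)
    then show ?case using mult_mono[OF st[of t], of 1 "den a t"] st[of t] by simp
  qed simp
  show "den a t \<le> den a (Suc t)"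
    using mult_right_mono[OF st[of t], of "den a t"] 1[of t] by simp
qed

lemma den_mono: "digits a n \<Longrightarrow> s \<le> t \<Longrightarrow> den a s \<le> den a t"
  by (rule lift_Suc_mono_le[of "den a"]) (use den_mono_step(2) in blast)

lemma cyl_step_bounds:
  assumes "digits a n" "0 \<le> y" "y \<le> 1"
  shows "0 \<le> 1 / (real (a (Suc t)) + y)" "1 / (real (a (Suc t)) + y) \<le> 1"
  using assms digitsD(3)[OF assms(1), of t] by (auto simp: divide_simps)

text \<open>\<open>cyl a t\<close> is a Moebius map of determinant 1 or -1 with denominator
  \<open>den a t * (1 + y * past a t)\<close>.\<close>

lemma cyl_diff:
  assumes "digits a n"
  shows "\<lbrakk>0 \<le> y; y \<le> 1; 0 \<le> z; z \<le> 1\<rbrakk> \<Longrightarrow>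
    \<bar>cyl a t y - cyl a t z\<bar> =
      \<bar>y - z\<bar> / ((den a t)\<^sup>2 * ((1 + y * past a t) * (1 + z * past a t)))"
proof (induction t arbitrary: y z)
  case (Suc t)
  let ?a = "real (a (Suc t))" and ?x = "past a t"
  have a: "1 \<le> ?a" and x: "0 \<le> ?x" "den a t \<ge> 1"
    using digitsD(3)[OF assms] past_bounds[OF assms] den_mono_step[OF assms] by auto
  have pos: "?a + y > 0" "?a + z > 0" "?a + ?x > 0" "?a + ?x + y > 0" "?a + ?x + z > 0"
    using a x Suc.prems by auto
  have "1 / (?a + y) - 1 / (?a + z) = (z - y) / ((?a + y) * (?a + z))"
    using pos by (simp add: field_simps)
  then have 1: "\<bar>1 / (?a + y) - 1 / (?a + z)\<bar> = \<bar>y - z\<bar> / ((?a + y) * (?a + z))"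
    using pos by (simp add: abs_mult)
  have 2: "1 + 1 / (?a + u) * ?x = (?a + ?x + u) / (?a + u)"
          "1 + u * (1 / (?a + ?x)) = (?a + ?x + u) / (?a + ?x)" if "u \<ge> 0" for u
    using that a x pos by (simp_all add: field_simps)
  have "\<bar>cyl a (Suc t) y - cyl a (Suc t) z\<bar> = \<bar>1 / (?a + y) - 1 / (?a + z)\<bar> /
      ((den a t)\<^sup>2 * ((1 + 1 / (?a + y) * ?x) * (1 + 1 / (?a + z) * ?x)))"
    using Suc.IH[of "1 / (?a + y)" "1 / (?a + z)"] cyl_step_bounds[OF assms, of y t]
      cyl_step_bounds[OF assms, of z t] Suc.prems by simp
  also have "\<dots> = \<bar>y - z\<bar> / ((den a t)\<^sup>2 * ((?a + ?x + y) * (?a + ?x + z)))"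
    unfolding 1 2(1)[OF Suc.prems(1)] 2(1)[OF Suc.prems(3)] using pos x by (simp add: divide_simps)
  also have "(den a t)\<^sup>2 * ((?a + ?x + y) * (?a + ?x + z)) =
     (den a (Suc t))\<^sup>2 * ((1 + y * past a (Suc t)) * (1 + z * past a (Suc t)))"
    unfolding past.simps den.simps 2(2)[OF Suc.prems(1)] 2(2)[OF Suc.prems(3)]
    using pos by (simp add: divide_simps power2_eq_square)
  finally show ?case .
qed simp

text \<open>By \<open>question_mark_inverse_add\<close>, a digit \<open>b\<close> reverses the order
  and divides differences by \<open>2 ^ b\<close>.\<close>

lemma question_mark_cyl_diff:
  assumes "digits a n"
  shows "\<lbrakk>0 \<le> y; y \<le> 1; 0 \<le> z; z \<le> 1\<rbrakk> \<Longrightarrow>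
    \<bar>question_mark (cyl a t y) - question_mark (cyl a t z)\<bar> =
      \<bar>question_mark y - question_mark z\<bar> / 2 ^ digsum a t"
proof (induction t arbitrary: y z)
  case (Suc t)
  obtain b where b: "a (Suc t) = Suc b" using digitsD(1)[OF assms, of t] by (cases "a (Suc t)") auto
  have "question_mark (1 / (real (a (Suc t)) + y)) - question_mark (1 / (real (a (Suc t)) + z)) =
     - ((question_mark y - question_mark z) / 2 ^ a (Suc t))"
    unfolding b question_mark_inverse_add[OF Suc.prems(1,2)] question_mark_inverse_add[OF Suc.prems(3,4)]
    by (simp add: divide_simps)
  then have "\<bar>question_mark (1 / (real (a (Suc t)) + y)) - question_mark (1 / (real (a (Suc t)) + z))\<bar> =
     \<bar>question_mark y - question_mark z\<bar> / 2 ^ a (Suc t)" by simp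
  then show ?case
    using Suc.IH[of "1 / (real (a (Suc t)) + y)" "1 / (real (a (Suc t)) + z)"]
      cyl_step_bounds[OF assms, of y t] cyl_step_bounds[OF assms, of z t] Suc.prems
    by (simp add: power_add mult.commute)
qed simp

lemma den_unbounded:
  assumes "digits a n"
  shows "real t \<le> den a (2 * t)"
proof (induction t)
  case 0
  show ?case by simp
next
  case (Suc t)
  have "0 \<le> past a (2 * t)" and "1 \<le> real (a (Suc (2 * t)))" "1 \<le> real (a (Suc (Suc (2 * t))))"
    and "1 \<le> den a (2 * t)"
    using past_bounds[OF assms] digitsD(3)[OF assms] den_mono_step[OF assms] by auto
  then have e: "past a (Suc (2 * t)) * den a (Suc (2 * t)) = den a (2 * t)" by simp
  have "1 * den a (Suc (2 * t)) \<le> real (a (Suc (Suc (2 * t)))) * den a (Suc (2 * t))"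
    using digitsD(3)[OF assms, of "Suc (2 * t)"] den_mono_step(1)[OF assms, of "Suc (2 * t)"]
    by (intro mult_right_mono) linarith+
  then have "den a (Suc (2 * t)) + den a (2 * t) \<le> den a (Suc (Suc (2 * t)))"
    unfolding den.simps(2)[of a "Suc (2 * t)"] distrib_right e by linarith
  moreover have "2 * Suc t = Suc (Suc (2 * t))" by simp
  ultimately show ?case
    using Suc den_mono_step(2)[OF assms, of "2 * t"] \<open>1 \<le> den a (2 * t)\<close> of_nat_Suc[of t, where ?'a = real]
    by (metis add.commute add_mono order_trans)
qed

lemma cyl_dist_le:
  assumes "digits a n" "0 \<le> y" "y \<le> 1" "0 \<le> z" "z \<le> 1"
  shows "\<bar>cyl a t y - cyl a t z\<bar> \<le> 1 / (den a t)\<^sup>2"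
proof -
  have "1 * 1 \<le> (1 + y * past a t) * (1 + z * past a t)"
    using past_bounds[OF assms(1)] assms by (intro mult_mono) auto
  moreover have "\<bar>y - z\<bar> \<le> 1" using assms by auto
  moreover have "0 < (den a t)\<^sup>2" using den_mono_step(1)[OF assms(1), of t] by simp
  ultimately show ?thesis
    unfolding cyl_diff[OF assms] by (intro frac_le) (auto simp: mult_le_cancel_left1)
qed

lemma cyl_dist_ge:
  assumes "digits a n" "0 \<le> y" "y \<le> 1" "0 \<le> z" "z \<le> 1"
  shows "\<bar>y - z\<bar> / (4 * (den a t)\<^sup>2) \<le> \<bar>cyl a t y - cyl a t z\<bar>"
proof -
  have "y * past a t \<le> 1" "z * past a t \<le> 1"
    using past_bounds[OF assms(1)] assms by (auto intro: mult_le_one)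
  then have "(1 + y * past a t) * (1 + z * past a t) \<le> 2 * 2"
    using past_bounds[OF assms(1)] assms by (intro mult_mono) auto
  moreover have "0 < (den a t)\<^sup>2" using den_mono_step(1)[OF assms(1), of t] by simp
  moreover have "0 < (1 + y * past a t) * (1 + z * past a t)"
    using past_bounds[OF assms(1)] assms by (intro mult_pos_pos add_pos_nonneg) auto
  ultimately show ?thesis
    unfolding cyl_diff[OF assms] by (intro divide_left_mono) (auto simp: mult.commute)
qed

lemma den_sq_eventually_large:
  assumes "digits a n" and r: "0 < r"
  shows "\<exists>T. \<forall>t\<ge>T. 1 / (den a t)\<^sup>2 < r"
proof -
  obtain k :: nat where k: "1 / r < real k" using reals_Archimedean2 by blast
  have k0: "0 < real k" using k r by (meson divide_pos_pos less_trans zero_less_one)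
  have "1 / (den a t)\<^sup>2 < r" if t: "2 * k \<le> t" for t
  proof -
    have "real k \<le> den a t" using den_unbounded[OF assms(1), of k] den_mono[OF assms(1) t] by simp
    moreover have "den a t * 1 \<le> den a t * den a t"
      using den_mono_step(1)[OF assms(1), of t] by (intro mult_left_mono) auto
    ultimately have "real k \<le> (den a t)\<^sup>2" by (simp add: power2_eq_square)
    then have "1 / (den a t)\<^sup>2 \<le> 1 / real k" using k0 by (intro frac_le) auto
    also have "\<dots> < r" using k k0 r by (simp add: field_simps)
    finally show ?thesis .
  qed
  then show ?thesis by blast
qed

lemma cyl_dist_tendsto_0:
  assumes "digits a n" "\<And>t. 0 \<le> y t" "\<And>t. y t \<le> 1" "\<And>t. 0 \<le> z t" "\<And>t. z t \<le> 1"
  shows "(\<lambda>t. cyl a t (y t) - cyl a t (z t)) \<longlonglongrightarrow> 0"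
proof (rule LIMSEQ_I)
  fix r :: real
  assume "0 < r"
  then obtain T where T: "\<And>t. T \<le> t \<Longrightarrow> 1 / (den a t)\<^sup>2 < r"
    using den_sq_eventually_large[OF assms(1)] by blast
  have "norm (cyl a t (y t) - cyl a t (z t) - 0) < r" if "T \<le> t" for t
    using T[OF that] cyl_dist_le[OF assms, of t t t] by simp
  then show "\<exists>no. \<forall>t\<ge>no. norm (cyl a t (y t) - cyl a t (z t) - 0) < r" by blast
qed

subsection \<open>The Gauss orbit of a point with bounded partial quotients\<close>

lemma S_eq_digsum: "S x t = digsum (pquot x) t"
  by (simp add: S_def digsum_def)

lemma gauss_orbit:
  assumes x: "0 < x" "x < 1" "x \<notin> \<rat>"
  shows "0 < (gauss_map ^^ t) x \<and> (gauss_map ^^ t) x < 1 \<and> (gauss_map ^^ t) x \<notin> \<rat>"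
proof (induction t)
  case (Suc t)
  let ?g = "(gauss_map ^^ t) x"
  have "1 / ?g \<notin> \<rat>"
  proof
    assume "1 / ?g \<in> \<rat>"
    from Rats_divide[OF Rats_1 this] have "?g \<in> \<rat>" by simp
    with Suc show False by simp
  qed
  have irr: "frac (1 / ?g) \<notin> \<rat>"
  proof
    assume "frac (1 / ?g) \<in> \<rat>"
    then have "frac (1 / ?g) + of_int \<lfloor>1 / ?g\<rfloor> \<in> \<rat>" by (intro Rats_add Rats_of_int)
    then show False using \<open>1 / ?g \<notin> \<rat>\<close> by (simp add: frac_def)
  qed
  then have "frac (1 / ?g) \<noteq> 0" using Rats_0 by metis
  then show ?case using irr frac_ge_0[of "1 / ?g"] frac_lt_1[of "1 / ?g"]
    by (simp add: gauss_map_def[of ?g] order_less_le)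
qed (use x in simp)

lemma pquot_orbit:
  assumes x: "0 < x" "x < 1" "x \<notin> \<rat>"
  shows "1 \<le> pquot x (Suc t)"
    and "(gauss_map ^^ t) x = 1 / (real (pquot x (Suc t)) + (gauss_map ^^ Suc t) x)"
proof -
  let ?g = "(gauss_map ^^ t) x"
  have g: "0 < ?g" "?g < 1" using gauss_orbit[OF x] by auto
  then have "1 \<le> 1 / ?g" by simp
  then have f: "1 \<le> \<lfloor>1 / ?g\<rfloor>" by linarith
  then show "1 \<le> pquot x (Suc t)" unfolding pquot_def by simp linarith
  have "real (pquot x (Suc t)) + (gauss_map ^^ Suc t) x = 1 / ?g"
  proof -
    have "real (nat \<lfloor>1 / ?g\<rfloor>) = of_int \<lfloor>1 / ?g\<rfloor>" by (rule of_nat_nat) (use f in linarith)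
    then show ?thesis by (simp add: pquot_def gauss_map_def frac_def)
  qed
  then show "?g = 1 / (real (pquot x (Suc t)) + (gauss_map ^^ Suc t) x)" by simp
qed

lemma E_digits: "x \<in> E n \<Longrightarrow> digits (pquot x) n"
proof -
  assume x: "x \<in> E n"
  then have x': "0 < x" "x < 1" "x \<notin> \<rat>" and le: "\<forall>j\<ge>1. pquot x j \<le> n" by (auto simp: E_def)
  have "1 \<le> pquot x j" if "1 \<le> j" for j
    using pquot_orbit(1)[OF x', of "j - 1"] that by simp
  with le show ?thesis by (simp add: digits_def)
qed

text \<open>A digit at most \<open>n\<close> keeps the point away from 0; applied to the next point
  of the orbit, this keeps it away from 1.\<close>

lemma orbit_bounds:
  assumes x: "x \<in> E n"
  shows "1 / (real n + 1) \<le> (gauss_map ^^ t) x" "(gauss_map ^^ t) x \<le> 1 - 1 / (real n + 2)"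
proof -
  have x': "0 < x" "x < 1" "x \<notin> \<rat>" using x by (auto simp: E_def)
  have lo: "1 / (real n + 1) \<le> (gauss_map ^^ t) x" for t
    unfolding pquot_orbit(2)[OF x', of t]
    using gauss_orbit[OF x', of "Suc t"] digitsD[OF E_digits[OF x], of t] by (intro frac_le) auto
  show "1 / (real n + 1) \<le> (gauss_map ^^ t) x" by (rule lo)
  have "(gauss_map ^^ t) x \<le> 1 / (1 + 1 / (real n + 1))"
    unfolding pquot_orbit(2)[OF x', of t]
    using lo[of "Suc t"] digitsD(3)[OF E_digits[OF x], of t] by (intro frac_le add_mono add_pos_nonneg) auto
  also have "\<dots> = 1 - 1 / (real n + 2)" by (simp add: field_simps)
  finally show "(gauss_map ^^ t) x \<le> 1 - 1 / (real n + 2)" .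
qed

lemma cyl_orbit:
  assumes x: "x \<in> E n"
  shows "cyl (pquot x) t ((gauss_map ^^ t) x) = x"
proof (induction t)
  case (Suc t)
  have x': "0 < x" "x < 1" "x \<notin> \<rat>" using x by (auto simp: E_def)
  show ?case
    using Suc unfolding pquot_orbit(2)[OF x', of t] cyl.simps(2) .
qed simp

text \<open>
  Take the deepest cylinder around \<open>x\<close> that still contains \<open>z\<close>. As the digits of \<open>x\<close> are bounded,
  \<open>x\<close> stays away from the boundary of the next cylinder, on a relative scale.
\<close>
lemma separating_cyl:
  assumes x: "x \<in> E n" and z: "0 \<le> z" "z \<le> 1" "z \<noteq> x"
  shows "\<exists>t y. 0 \<le> y \<and> y \<le> 1 \<and> z = cyl (pquot x) t y \<and>
           1 / (real n + 2) ^ 3 \<le> \<bar>y - (gauss_map ^^ t) x\<bar>"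
proof (rule ccontr)
  assume neg: "\<not> ?thesis"
  let ?a = "pquot x" and ?g = "\<lambda>t. (gauss_map ^^ t) x"
  have x': "0 < x" "x < 1" "x \<notin> \<rat>" using x by (auto simp: E_def)
  have dig: "digits ?a n" by (rule E_digits[OF x])
  \<comment> \<open>If \<open>x\<close> and \<open>z\<close> are never separated, \<open>z\<close>
    lies in all cylinders around \<open>x\<close>, whose lengths tend to 0.\<close>
  have "\<exists>y. 0 \<le> y \<and> y \<le> 1 \<and> z = cyl ?a t y" for t
  proof (induction t)
    case 0
    then show ?case using z by auto
  next
    case (Suc t)
    then obtain y where y: "0 \<le> y" "y \<le> 1" "z = cyl ?a t y" by blast
    let ?b = "real (?a (Suc t))" and ?h = "?g (Suc t)"
    have near: "\<bar>y - ?g t\<bar> < 1 / (real n + 2) ^ 3"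
    proof (rule ccontr)
      assume "\<not> ?thesis"
      then have "1 / (real n + 2) ^ 3 \<le> \<bar>y - ?g t\<bar>" by simp
      with y neg show False by blast
    qed
    have g: "?g t = 1 / (?b + ?h)" using pquot_orbit(2)[OF x'] .
    have b: "1 \<le> ?b" "?b \<le> real n" using digitsD[OF dig] by auto
    have h: "1 / (real n + 1) \<le> ?h" "?h \<le> 1 - 1 / (real n + 2)" "0 < ?h" "?h < 1"
      using orbit_bounds[OF x, of "Suc t"] gauss_orbit[OF x', of "Suc t"] by (simp_all del: funpow.simps)
    \<comment> \<open>The next cylinder ends at \<open>1 / ?b\<close> and
      \<open>1 / (?b + 1)\<close>. One factor bounds the distance of \<open>?h\<close> from 0 and 1,
      the other two the product of the denominators.\<close>
    have cube: "1 / (real n + 2) ^ 3 = (1 / (real n + 2)) / ((real n + 2) * (real n + 2))"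
      by (simp add: power3_eq_cube)
    have hi: "y \<le> 1 / ?b"
    proof (rule ccontr)
      assume "\<not> y \<le> 1 / ?b"
      then have "1 / ?b - 1 / (?b + ?h) \<le> \<bar>y - ?g t\<bar>" using g by linarith
      moreover have "1 / ?b - 1 / (?b + ?h) = ?h / (?b * (?b + ?h))"
        using b h by (simp add: field_simps)
      moreover have "1 / (real n + 2) ^ 3 \<le> ?h / (?b * (?b + ?h))"
        unfolding cube
      proof (rule frac_le)
        show "1 / (real n + 2) \<le> ?h" using h(1) by (rule order_trans[rotated]) (simp add: frac_le)
        show "?b * (?b + ?h) \<le> (real n + 2) * (real n + 2)" using b h by (intro mult_mono) auto
      qed (use b h in auto)
      ultimately show False using near by linarith
    qed
    have lo: "1 / (?b + 1) \<le> y"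
    proof (rule ccontr)
      assume "\<not> 1 / (?b + 1) \<le> y"
      then have "1 / (?b + ?h) - 1 / (?b + 1) \<le> \<bar>y - ?g t\<bar>" using g by linarith
      moreover have "1 / (?b + ?h) - 1 / (?b + 1) = (1 - ?h) / ((?b + 1) * (?b + ?h))"
        using b h by (simp add: divide_simps)
      moreover have "1 / (real n + 2) ^ 3 \<le> (1 - ?h) / ((?b + 1) * (?b + ?h))"
        unfolding cube
      proof (rule frac_le)
        show "(?b + 1) * (?b + ?h) \<le> (real n + 2) * (real n + 2)" using b h by (intro mult_mono) auto
      qed (use b h in auto)
      ultimately show False using near by linarith
    qed
    have "0 < 1 / (?b + 1)" using b by simp
    with lo have "0 < y" by linarith
    then have "0 \<le> 1 / y - ?b" "1 / y - ?b \<le> 1" "z = cyl ?a (Suc t) (1 / y - ?b)"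
      using lo hi b y(3) by (simp_all add: field_simps)
    then show ?case by blast
  qed
  then obtain y where y: "\<And>t. 0 \<le> y t" "\<And>t. y t \<le> 1" "\<And>t. z = cyl ?a t (y t)" by metis
  have "(\<lambda>t. cyl ?a t (y t) - cyl ?a t (?g t)) \<longlonglongrightarrow> 0"
    using gauss_orbit[OF x'] by (intro cyl_dist_tendsto_0[OF dig]) (auto simp: y less_imp_le)
  moreover have "(\<lambda>t. cyl ?a t (y t) - cyl ?a t (?g t)) = (\<lambda>t. z - x)"
    unfolding y(3)[symmetric] cyl_orbit[OF x] ..
  ultimately have "(\<lambda>t. z - x) \<longlonglongrightarrow> 0" by (simp only:)
  then show False using z(3) by (simp add: LIMSEQ_const_iff)
qed

text \<open>In the separating cylinder of a nearby \<open>z\<close>, of order \<open>t\<close>, the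
  points differ by at least a constant over \<open>(den (pquot x) t)^2\<close> and their images by
  at most \<open>1 / 2 ^ S x t\<close>.\<close>

lemma question_mark_deriv_zeroI:
  assumes x: "x \<in> E n" and lim: "(\<lambda>t. (den (pquot x) t)\<^sup>2 / 2 ^ S x t) \<longlonglongrightarrow> 0"
  shows "(question_mark has_real_derivative 0) (at x)"
  unfolding has_field_derivative_iff
proof (rule tendstoI)
  fix e :: real
  assume e: "0 < e"
  let ?a = "pquot x" and ?g = "\<lambda>t. (gauss_map ^^ t) x"
  have x': "0 < x" "x < 1" "x \<notin> \<rat>" using x by (auto simp: E_def)
  have dig: "digits ?a n" by (rule E_digits[OF x])
  define c where "c = 1 / (real n + 2) ^ 3"
  have c: "0 < c" unfolding c_def by simp
  have dpos: "0 < den ?a t" for t using den_mono_step(1)[OF dig, of t] by simp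
  have "0 < e * c / 4" using e c by simp
  from LIMSEQ_D[OF lim this] obtain T where
    T: "\<And>t. T \<le> t \<Longrightarrow> (den ?a t)\<^sup>2 / 2 ^ S x t < e * c / 4" by auto
  \<comment> \<open>The first bound keeps \<open>z\<close> in \<open>[0, 1]\<close>, the second
    forces the separating cylinder to have order at least \<open>T\<close>.\<close>
  define d where "d = min (min x (1 - x)) (c / (4 * (den ?a T)\<^sup>2))"
  have "0 < c / (4 * (den ?a T)\<^sup>2)" using c dpos[of T] by simp
  then have d: "0 < d" unfolding d_def using x' by simp
  have "\<bar>(question_mark z - question_mark x) / (z - x)\<bar> < e" if z: "z \<noteq> x" "dist z x < d" for z
  proof -
    have "\<bar>z - x\<bar> < min x (1 - x)" using z unfolding d_def dist_real_def by simp
    then have z01: "0 \<le> z" "z \<le> 1" by auto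
    obtain t y where ty: "0 \<le> y" "y \<le> 1" "z = cyl ?a t y" "c \<le> \<bar>y - ?g t\<bar>"
      using separating_cyl[OF x z01 z(1)] unfolding c_def by blast
    have g: "0 \<le> ?g t" "?g t \<le> 1" using gauss_orbit[OF x', of t] by auto
    have "c / (4 * (den ?a t)\<^sup>2) \<le> \<bar>y - ?g t\<bar> / (4 * (den ?a t)\<^sup>2)"
      by (rule divide_right_mono[OF ty(4)]) simp
    also have "\<dots> \<le> \<bar>z - x\<bar>"
      using cyl_dist_ge[OF dig ty(1,2) g, of t] unfolding cyl_orbit[OF x] ty(3)[symmetric] .
    finally have far: "c / (4 * (den ?a t)\<^sup>2) \<le> \<bar>z - x\<bar>" .
    have "T \<le> t"
    proof (rule ccontr)
      assume "\<not> T \<le> t"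
      then have "(den ?a t)\<^sup>2 \<le> (den ?a T)\<^sup>2"
        using den_mono[OF dig, of t T] dpos[of t] by (intro power_mono) auto
      then have "c / (4 * (den ?a T)\<^sup>2) \<le> c / (4 * (den ?a t)\<^sup>2)"
        using c dpos[of t] by (intro frac_le) auto
      then show False using far z unfolding d_def dist_real_def by linarith
    qed
    have "\<bar>question_mark z - question_mark x\<bar> = \<bar>question_mark y - question_mark (?g t)\<bar> / 2 ^ S x t"
      using question_mark_cyl_diff[OF dig ty(1,2) g, of t]
      unfolding cyl_orbit[OF x] ty(3)[symmetric] S_eq_digsum .
    also have "\<dots> \<le> 1 / 2 ^ S x t"
      using question_mark_nonneg[OF ty(1,2)] question_mark_le_1[OF ty(1,2)]
        question_mark_nonneg[OF g] question_mark_le_1[OF g] by (intro divide_right_mono) auto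
    finally have up: "\<bar>question_mark z - question_mark x\<bar> \<le> 1 / 2 ^ S x t" .
    have pos: "0 < c / (4 * (den ?a t)\<^sup>2)" using c dpos[of t] by simp
    have "\<bar>(question_mark z - question_mark x) / (z - x)\<bar> \<le> (1 / 2 ^ S x t) / (c / (4 * (den ?a t)\<^sup>2))"
      unfolding abs_divide by (rule frac_le[OF _ up pos far]) simp
    also have "\<dots> = (den ?a t)\<^sup>2 / 2 ^ S x t * (4 / c)" using c by simp
    also have "\<dots> < (e * c / 4) * (4 / c)" using T[OF \<open>T \<le> t\<close>] c by (intro mult_strict_right_mono) auto
    also have "\<dots> = e" using c by simp
    finally show ?thesis .
  qed
  then show "\<forall>\<^sub>F z in at x. dist ((question_mark z - question_mark x) / (z - x)) 0 < e"
    unfolding eventually_at using d by (auto simp: dist_real_def)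
qed

text \<open>The derivative is tested along the convergents \<open>cyl (pquot x) t 0\<close>, where
  both differences are known exactly.\<close>

lemma question_mark_deriv_zeroD:
  assumes x: "x \<in> E n" and deriv: "(question_mark has_real_derivative 0) (at x)"
  shows "(\<lambda>t. (den (pquot x) t)\<^sup>2 / 2 ^ S x t) \<longlonglongrightarrow> 0"
proof -
  let ?a = "pquot x" and ?g = "\<lambda>t. (gauss_map ^^ t) x"
  let ?z = "\<lambda>t. cyl ?a t 0" and ?r = "\<lambda>z. (question_mark z - question_mark x) / (z - x)"
  have x': "0 < x" "x < 1" "x \<notin> \<rat>" using x by (auto simp: E_def)
  have dig: "digits ?a n" by (rule E_digits[OF x])
  have dpos: "0 < den ?a t" for t using den_mono_step(1)[OF dig, of t] by simp
  have g: "0 \<le> ?g t" "?g t \<le> 1" "0 < ?g t" for t using gauss_orbit[OF x', of t] by auto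
  have dist: "\<bar>?z t - x\<bar> = ?g t / ((den ?a t)\<^sup>2 * (1 + ?g t * past ?a t))" for t
    using cyl_diff[OF dig _ _ g(1,2), of 0 t t] g(1)[of t] unfolding cyl_orbit[OF x] by simp
  have fac: "1 \<le> 1 + ?g t * past ?a t" for t using g(1)[of t] past_bounds[OF dig, of t] by simp
  have ne: "?z t \<noteq> x" for t using dist[of t] g(3)[of t] dpos[of t] fac[of t] by auto
  have "(\<lambda>t. ?z t - cyl ?a t (?g t)) \<longlonglongrightarrow> 0"
    using g by (intro cyl_dist_tendsto_0[OF dig]) auto
  then have "?z \<longlonglongrightarrow> x" unfolding cyl_orbit[OF x] by (simp add: LIM_zero_iff)
  then have "filterlim ?z (at x) sequentially" using ne by (simp add: filterlim_at)
  moreover have "(?r \<longlongrightarrow> 0) (at x)" using deriv by (simp add: has_field_derivative_iff)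
  ultimately have "(\<lambda>t. ?r (?z t)) \<longlonglongrightarrow> 0" by (rule filterlim_compose[rotated])
  then have "(\<lambda>t. 2 ^ n * \<bar>?r (?z t)\<bar>) \<longlonglongrightarrow> 2 ^ n * \<bar>0\<bar>" by (intro tendsto_intros)
  then have lim: "(\<lambda>t. 2 ^ n * \<bar>?r (?z t)\<bar>) \<longlonglongrightarrow> 0" by simp
  have "norm ((den ?a t)\<^sup>2 / 2 ^ S x t) \<le> 2 ^ n * \<bar>?r (?z t)\<bar>" for t
  proof -
    \<comment> \<open>\<open>?g t\<close> is at least \<open>1 / (n + 1)\<close>, where the question
      mark function has the value \<open>1 / 2 ^ n\<close>.\<close>
    have "1 / 2 ^ n = question_mark (1 / (real (Suc n) + 0))"
      unfolding question_mark_inverse_add[OF order_refl zero_le_one] by simp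
    also have "\<dots> \<le> question_mark (?g t)"
      using orbit_bounds(1)[OF x, of t] g(2)[of t] by (intro question_mark_mono) (auto simp: add.commute)
    finally have lo: "1 / 2 ^ n \<le> question_mark (?g t)" .
    have q: "\<bar>question_mark (?z t) - question_mark x\<bar> = question_mark (?g t) / 2 ^ S x t"
      using question_mark_cyl_diff[OF dig _ _ g(1,2), of 0 t t] question_mark_nonneg[OF g(1,2), of t]
      unfolding cyl_orbit[OF x] S_eq_digsum by simp
    have "1 \<le> (1 + ?g t * past ?a t) / ?g t" using fac[of t] g(2,3)[of t] by (simp add: le_divide_eq)
    then have "(1 / 2 ^ n) * 1 \<le> question_mark (?g t) * ((1 + ?g t * past ?a t) / ?g t)"
      using lo by (intro mult_mono) (auto intro: order_trans[rotated])
    then have "((den ?a t)\<^sup>2 / 2 ^ S x t) * (1 / 2 ^ n) \<le>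
        ((den ?a t)\<^sup>2 / 2 ^ S x t) * (question_mark (?g t) * ((1 + ?g t * past ?a t) / ?g t))"
      by (intro mult_left_mono) auto
    also have "\<dots> = \<bar>?r (?z t)\<bar>"
      unfolding abs_divide q dist using g(3)[of t] fac[of t] dpos[of t] by (simp add: field_simps)
    finally show ?thesis by (simp add: field_simps)
  qed
  then show ?thesis using lim by (rule Lim_null_comparison[OF always_eventually, OF allI])
qed

subsection \<open>Points with prescribed partial quotients\<close>

lemma cyl_bounds:
  "digits a n \<Longrightarrow> 0 \<le> y \<Longrightarrow> y \<le> 1 \<Longrightarrow> 0 \<le> cyl a t y \<and> cyl a t y \<le> 1"
proof (induction t arbitrary: y)
  case (Suc t)
  then show ?case using cyl_step_bounds[of a n y t] by simp
qed simp

text \<open>Peels off the outermost digit, whereas the recursion of \<open>cyl\<close> works at the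
  innermost one.\<close>

lemma cyl_Suc_shift: "cyl a (Suc t) y = 1 / (real (a 1) + cyl (\<lambda>j. a (Suc j)) t y)"
proof (induction t arbitrary: y)
  case (Suc t)
  show ?case using Suc[of "1 / (real (a (Suc (Suc t))) + y)"] by simp
qed simp

lemma cyl_nested:
  "digits a n \<Longrightarrow> 0 \<le> y \<Longrightarrow> y \<le> 1 \<Longrightarrow> \<exists>z. 0 \<le> z \<and> z \<le> 1 \<and> cyl a (t + i) y = cyl a t z"
proof (induction i arbitrary: y)
  case (Suc i)
  then show ?case using cyl_step_bounds[of a n y "t + i"] by simp
qed auto

lemma cyl_convergent:
  assumes dig: "digits a n"
  shows "convergent (\<lambda>t. cyl a t 1)"
proof -
  have "\<exists>M. \<forall>s\<ge>M. \<forall>t\<ge>M. norm (cyl a s 1 - cyl a t 1) < e" if e: "0 < e" for e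
  proof -
    have "0 < e / 2" using e by simp
    from den_sq_eventually_large[OF dig this] obtain T where T: "1 / (den a T)\<^sup>2 < e / 2" by blast
    have near: "\<bar>cyl a t 1 - cyl a T 1\<bar> < e / 2" if "T \<le> t" for t
    proof -
      obtain z where z: "0 \<le> z" "z \<le> 1" "cyl a (T + (t - T)) 1 = cyl a T z"
        using cyl_nested[OF dig, of 1 T "t - T"] by auto
      then show ?thesis using cyl_dist_le[OF dig z(1,2), of 1 T] T that by simp
    qed
    have "norm (cyl a s 1 - cyl a t 1) < e" if "T \<le> s" "T \<le> t" for s t
      using near[OF that(1)] near[OF that(2)] unfolding real_norm_def by linarith
    then show ?thesis by blast
  qed
  then have "Cauchy (\<lambda>t. cyl a t 1)" by (rule CauchyI)
  then show ?thesis by (simp add: Cauchy_convergent_iff)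
qed

definition cfrac :: "(nat \<Rightarrow> nat) \<Rightarrow> real" where
  "cfrac a = lim (\<lambda>t. cyl a t 1)"

lemma digits_shift: "digits a n \<Longrightarrow> digits (\<lambda>j. a (k + j)) n"
  by (simp add: digits_def)

lemma cfrac_tendsto: "digits a n \<Longrightarrow> (\<lambda>t. cyl a t 1) \<longlonglongrightarrow> cfrac a"
  unfolding cfrac_def using cyl_convergent convergent_LIMSEQ_iff by blast

lemma cfrac_step:
  assumes dig: "digits a n"
  shows "cfrac (\<lambda>j. a (k + j)) = 1 / (real (a (Suc k)) + cfrac (\<lambda>j. a (Suc k + j)))"
    and "0 < cfrac (\<lambda>j. a (k + j))" "cfrac (\<lambda>j. a (k + j)) < 1"
proof -
  have nonneg: "0 \<le> cfrac (\<lambda>j. a (k + j))" for k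
    by (rule LIMSEQ_le_const[OF cfrac_tendsto[OF digits_shift[OF dig]]])
      (use cyl_bounds[OF digits_shift[OF dig]] in auto)
  have b: "1 \<le> real (a (Suc k))" for k by (rule digitsD(3)[OF dig])
  have st: "cfrac (\<lambda>j. a (k + j)) = 1 / (real (a (Suc k)) + cfrac (\<lambda>j. a (Suc k + j)))" for k
  proof (rule LIMSEQ_unique)
    show "(\<lambda>t. cyl (\<lambda>j. a (k + j)) (Suc t) 1) \<longlonglongrightarrow> cfrac (\<lambda>j. a (k + j))"
      by (rule LIMSEQ_Suc[OF cfrac_tendsto[OF digits_shift[OF dig]]])
    have "(\<lambda>t. 1 / (real (a (Suc k)) + cyl (\<lambda>j. a (Suc k + j)) t 1)) \<longlonglongrightarrow>
        1 / (real (a (Suc k)) + cfrac (\<lambda>j. a (Suc k + j)))"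
      using b[of k] nonneg[of "Suc k"]
      by (intro tendsto_intros cfrac_tendsto[OF digits_shift[OF dig]]) auto
    then show "(\<lambda>t. cyl (\<lambda>j. a (k + j)) (Suc t) 1) \<longlonglongrightarrow>
        1 / (real (a (Suc k)) + cfrac (\<lambda>j. a (Suc k + j)))"
      unfolding cyl_Suc_shift by simp
  qed
  have pos: "0 < cfrac (\<lambda>j. a (k + j))" for k
    unfolding st[of k] using b[of k] nonneg[of "Suc k"] by (auto intro!: divide_pos_pos add_pos_nonneg)
  show "cfrac (\<lambda>j. a (k + j)) = 1 / (real (a (Suc k)) + cfrac (\<lambda>j. a (Suc k + j)))" by (rule st)
  show "0 < cfrac (\<lambda>j. a (k + j))" by (rule pos)
  show "cfrac (\<lambda>j. a (k + j)) < 1"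
    unfolding st[of k] using b[of k] pos[of "Suc k"] by (simp add: divide_less_eq add_pos_pos)
qed

text \<open>Infinite descent: if a tail equals \<open>p / q\<close>, inverting it and removing the
  integer part gives the next tail the smaller denominator \<open>p\<close>.\<close>

lemma cfrac_irrational:
  assumes dig: "digits a n"
  shows "cfrac (\<lambda>j. a (k + j)) \<notin> \<rat>"
proof -
  let ?x = "\<lambda>k. cfrac (\<lambda>j. a (k + j))"
  have "\<not> (0 < q \<and> ?x k * real q = of_int p)" for q k and p :: int
  proof (induction q arbitrary: k p rule: less_induct)
    case (less q)
    show ?case
    proof
      assume h: "0 < q \<and> ?x k * real q = of_int p"
      have x: "0 < ?x k" "?x k < 1" by (rule cfrac_step(2,3)[OF dig])+
      have "0 < ?x k * real q" "?x k * real q < 1 * real q"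
        by (intro mult_pos_pos mult_strict_right_mono; use h x in simp)+
      then have "0 < real_of_int p" "real_of_int p < real_of_int (int q)" using h by simp_all
      then have p: "0 < p" "p < int q" unfolding of_int_less_iff of_int_0_less_iff .
      have "1 / ?x k = real (a (Suc k)) + ?x (Suc k)" using cfrac_step(1)[OF dig, of k] by simp
      then have "?x (Suc k) * of_int p = (1 / ?x k - real (a (Suc k))) * of_int p" by simp
      also have "\<dots> = (1 / ?x k - real (a (Suc k))) * (?x k * real q)" using h by simp
      also have "\<dots> = real q - real (a (Suc k)) * (?x k * real q)" using x by (simp add: field_simps)
      also have "\<dots> = of_int (int q - int (a (Suc k)) * p)" using h by simp
      finally have "?x (Suc k) * real (nat p) = of_int (int q - int (a (Suc k)) * p)" using p by simp
      moreover have "nat p < q" "0 < nat p" using p by linarith+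
      ultimately show False using less.IH by blast
    qed
  qed
  moreover have "\<exists>q p. 0 < q \<and> r * real q = of_int p" if "r \<in> \<rat>" for r :: real
  proof -
    obtain p q where "r = of_int p / of_int q" "0 < q" using \<open>r \<in> \<rat>\<close> by (rule Rats_cases') 
    then have "0 < nat q \<and> r * real (nat q) = of_int p" by simp
    then show ?thesis by blast
  qed
  ultimately show ?thesis by blast
qed

lemma E_prescribed:
  assumes dig: "digits a n"
  shows "\<exists>x\<in>E n. \<forall>j\<ge>1. pquot x j = a j"
proof -
  let ?x = "\<lambda>k. cfrac (\<lambda>j. a (k + j))"
  have x: "0 < ?x k" "?x k < 1" for k by (rule cfrac_step(2,3)[OF dig])+
  have inv: "1 / ?x k = real (a (Suc k)) + ?x (Suc k)" for k
    using cfrac_step(1)[OF dig, of k] by simp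
  have fl: "\<lfloor>1 / ?x k\<rfloor> = int (a (Suc k))" for k
    unfolding inv using x[of "Suc k"] by (intro floor_unique) auto
  have orb: "(gauss_map ^^ k) (?x 0) = ?x k" for k
  proof (induction k)
    case (Suc k)
    have "gauss_map (?x k) = 1 / ?x k - of_int \<lfloor>1 / ?x k\<rfloor>" by (simp only: gauss_map_def frac_def)
    also have "\<dots> = ?x (Suc k)" unfolding fl unfolding inv by simp
    finally have "gauss_map (?x k) = ?x (Suc k)" .
    with Suc show ?case by simp
  qed simp
  have pq: "pquot (?x 0) j = a j" if "1 \<le> j" for j
    using fl[of "j - 1"] that unfolding pquot_def orb by simp
  have "?x 0 \<in> E n"
    unfolding E_def using x[of 0] cfrac_irrational[OF dig, of 0] pq dig by (auto simp: digits_def)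
  with pq show ?thesis by blast
qed

section \<open>A concave potential on continuants\<close>

definition gold :: real where "gold = (1 + sqrt 5) / 2"

lemma gold_sq: "gold * gold = gold + 1"
  by (simp add: gold_def field_simps)

lemma gold_bounds: "8 / 5 \<le> gold" "gold \<le> 13 / 8"
proof -
  have "11 / 5 \<le> sqrt 5" by (rule real_le_rsqrt) (simp add: power2_eq_square)
  moreover have "sqrt 5 \<le> 9 / 4" by (rule real_le_lsqrt) (simp_all add: power2_eq_square)
  ultimately show "8 / 5 \<le> gold" "gold \<le> 13 / 8" by (simp_all add: gold_def)
qed

section \<open>Elementary inequalities for \<open>exp\<close> and \<open>ln\<close>\<close>

lemma ln_ge_one_minus: "0 < (x :: real) \<Longrightarrow> 1 - 1 / x \<le> ln x"
  using ln_le_minus_one[of "1 / x"] by (simp add: ln_div)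

lemma exp_chord:
  fixes s :: real
  assumes "0 \<le> \<tau>" "\<tau> \<le> 1"
  shows "exp (\<tau> * s) \<le> 1 - \<tau> + \<tau> * exp s"
  using convex_onD[OF exp_convex, of \<tau> 0 s] assms by simp

text \<open>The chord of \<open>exp\<close> from 0 to \<open>2 * s\<close> is compared with the
  shorter chords that meet at \<open>s\<close>; they lie below it by exactly \<open>\<theta>\<close>
  or \<open>1 - \<theta>\<close> times \<open>(exp s - 1)^2\<close>.\<close>

lemma chord_gap:
  fixes s :: real
  assumes "0 \<le> \<epsilon>" "\<epsilon> \<le> \<theta>" "\<epsilon> \<le> 1 - \<theta>"
  shows "exp (\<theta> * (2 * s)) + \<epsilon> * (exp s - 1)\<^sup>2 \<le> 1 - \<theta> + \<theta> * (exp s)\<^sup>2"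
proof (cases "\<theta> \<le> 1 / 2")
  case True
  have "exp (\<theta> * (2 * s)) \<le> 1 - 2 * \<theta> + 2 * \<theta> * exp s"
    using exp_chord[of "2 * \<theta>" s] True assms by (simp add: ac_simps)
  moreover have "\<epsilon> * (exp s - 1)\<^sup>2 \<le> \<theta> * (exp s - 1)\<^sup>2" using assms by (intro mult_right_mono) auto
  ultimately show ?thesis by (simp add: power2_eq_square algebra_simps)
next
  case False
  have "exp (\<theta> * (2 * s)) = exp s * exp ((2 * \<theta> - 1) * s)"
    by (simp add: exp_add[symmetric] algebra_simps)
  also have "\<dots> \<le> exp s * (1 - (2 * \<theta> - 1) + (2 * \<theta> - 1) * exp s)"
    using exp_chord[of "2 * \<theta> - 1" s] False assms by (intro mult_left_mono) auto
  finally have "exp (\<theta> * (2 * s)) \<le> exp s * (1 - (2 * \<theta> - 1) + (2 * \<theta> - 1) * exp s)" .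
  moreover have "\<epsilon> * (exp s - 1)\<^sup>2 \<le> (1 - \<theta>) * (exp s - 1)\<^sup>2"
    using assms by (intro mult_right_mono) auto
  ultimately show ?thesis by (simp add: power2_eq_square algebra_simps)
qed

section \<open>The two regimes and their linear forms\<close>

locale digit_bound =
  fixes n :: nat
  assumes n5: "5 \<le> n"
begin

lemma n_real: "5 \<le> real n" using n5 by simp

text \<open>
  \<open>mu\<close> is \<open>[0; 1, n, 1, n, \<dots>]\<close>, and \<open>lam\<close> is the growth of continuants over a period \<open>1, n\<close>.
\<close>
definition mu :: real where "mu = (sqrt ((real n)\<^sup>2 + 4 * real n) - real n) / 2"
definition lam :: real where "lam = real n + 1 + mu"

lemma mu_bounds: "4 / 5 \<le> mu" "mu < 1"
proof -
  have "real n + 8 / 5 \<le> sqrt ((real n)\<^sup>2 + 4 * real n)"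
    using n_real by (intro real_le_rsqrt) (simp add: power2_eq_square field_simps)
  moreover have "sqrt ((real n)\<^sup>2 + 4 * real n) < real n + 2"
    by (rule real_less_lsqrt) (simp_all add: power2_eq_square field_simps)
  ultimately show "4 / 5 \<le> mu" "mu < 1" by (simp_all add: mu_def)
qed

lemma mu_sq: "mu * mu = real n * (1 - mu)"
proof -
  have "sqrt ((real n)\<^sup>2 + 4 * real n) * sqrt ((real n)\<^sup>2 + 4 * real n) = (real n)\<^sup>2 + 4 * real n" by simp
  then show ?thesis unfolding mu_def by (simp add: field_simps power2_eq_square)
qed

lemma lam_bounds: "34 / 5 \<le> lam" "lam \<le> real n + 2"
  using mu_bounds n_real by (simp_all add: lam_def)

definition A :: real where "A = (gold + 2) / (mu + 3)"

lemma A_eq: "A * mu = gold + 2 - 3 * A"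
  using mu_bounds by (simp add: A_def field_simps)

lemma A_bounds: "9 / 10 \<le> A" "A \<le> 1"
  using mu_bounds gold_bounds by (simp_all add: A_def field_simps)

text \<open>
  Up to scaling, \<open>lf\<close>, \<open>pf\<close>, \<open>qf\<close> are the limits of the growth of a continuant, as a function of
  its last two denominators \<open>u\<close>, \<open>v\<close>, when it is continued by \<open>1, 1, \<dots>\<close>, by \<open>1, n, 1, n, \<dots>\<close>
  and by \<open>n, 1, n, 1, \<dots>\<close>. The scaling \<open>A\<close> makes \<open>lf\<close> and \<open>pf\<close> agree at \<open>v / u = 1/3\<close>;
  then \<open>lf\<close> and \<open>qf\<close> agree at \<open>v / u = 3/4\<close>.
\<close>
definition lf :: "real \<Rightarrow> real \<Rightarrow> real" where "lf u v = u + (gold - 1) * v"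
definition pf :: "real \<Rightarrow> real \<Rightarrow> real" where "pf u v = A * (u + mu * v)"
definition qf :: "real \<Rightarrow> real \<Rightarrow> real" where "qf u v = gold * A * (mu * u + (1 - mu) * v)"

definition psi :: "real \<Rightarrow> real \<Rightarrow> real" where "psi u v = min (lf u v) (min (pf u v) (qf u v))"

text \<open>A digit \<open>a\<close> turns the last two denominators \<open>(u, v)\<close> into
  \<open>(a * u + v, u)\<close>. Here and in the next two lemmas the forms are eigenvectors:
  \<open>lf\<close> for the digit 1, and \<open>qf\<close> for the pair \<open>n, 1\<close> with
  eigenvalue \<open>lam\<close>.\<close>

lemma lf_one: "lf (u + v) u = gold * lf u v"
proof -
  have "gold * lf u v = gold * u + (gold * gold - gold) * v" by (simp add: lf_def algebra_simps)
  then show ?thesis unfolding gold_sq by (simp add: lf_def algebra_simps)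
qed

lemma qf_one: "qf (u + v) u = gold * pf u v"
  by (simp add: qf_def pf_def algebra_simps)

lemma pf_n: "pf (real n * u + v) u = lam / gold * qf u v"
proof -
  have "lam * mu = real n * mu + mu + mu * mu" by (simp add: lam_def algebra_simps)
  then have 1: "lam * mu = real n + mu" unfolding mu_sq by (simp add: algebra_simps)
  have "lam * (1 - mu) = real n + 1 + mu - (real n * mu + mu + mu * mu)"
    by (simp add: lam_def algebra_simps)
  then have 2: "lam * (1 - mu) = 1" unfolding mu_sq by (simp add: algebra_simps)
  have "lam / gold * qf u v = A * ((lam * mu) * u + (lam * (1 - mu)) * v)"
    using gold_bounds by (simp add: qf_def algebra_simps)
  then show ?thesis unfolding 1 2 by (simp add: pf_def algebra_simps)
qed

lemma pf_minus_lf: "pf u v - lf u v = (A * mu - (gold - 1)) * (v - u / 3)"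
  unfolding pf_def lf_def distrib_left mult.assoc[symmetric] A_eq by (simp add: algebra_simps)

text \<open>The zero at 3/4 is the image \<open>1 / (1 + 1 / 3)\<close> of the zero of
  \<open>pf - lf\<close> under the digit 1, in accordance with \<open>lf_one\<close> and
  \<open>qf_one\<close>.\<close>

lemma lf_minus_qf: "lf u v - qf u v = (gold - 1 - gold * A * (1 - mu)) * (v - 3 / 4 * u)"
proof -
  have "4 * (lf u v - qf u v) = (gold - 1 - gold * A * (1 - mu)) * (4 * v - 3 * u)"
    unfolding lf_def qf_def using A_eq gold_sq by algebra
  then show ?thesis by (simp add: right_diff_distrib)
qed

lemma K1_pos: "0 < A * mu - (gold - 1)"
proof -
  have "9 / 10 * (4 / 5) \<le> A * mu" using A_bounds mu_bounds by (intro mult_mono) auto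
  then show ?thesis using gold_bounds by simp
qed

lemma K2_ge: "27 / 100 \<le> gold - 1 - gold * A * (1 - mu)"
proof -
  have "gold * A * (1 - mu) \<le> 13 / 8 * 1 * (1 / 5)"
    using A_bounds mu_bounds gold_bounds by (intro mult_mono) auto
  then show ?thesis using gold_bounds by simp
qed

lemma pf_le_lf: "3 * v \<le> u \<Longrightarrow> pf u v \<le> lf u v"
  using pf_minus_lf[of u v] K1_pos mult_nonneg_nonpos[of "A * mu - (gold - 1)" "v - u / 3"] by linarith

lemma lf_le_pf: "u \<le> 3 * v \<Longrightarrow> lf u v \<le> pf u v"
  using pf_minus_lf[of u v] K1_pos mult_nonneg_nonneg[of "A * mu - (gold - 1)" "v - u / 3"] by linarith

lemma lf_le_qf: "4 * v \<le> 3 * u \<Longrightarrow> lf u v \<le> qf u v"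
  using lf_minus_qf[of u v] K2_ge
    mult_nonneg_nonpos[of "gold - 1 - gold * A * (1 - mu)" "v - 3 / 4 * u"] by simp

text \<open>\<open>9 / 400\<close> is the slope bound \<open>27 / 100\<close> times
  \<open>1 / 12\<close>, the distance from 3/4 to 2/3 here and to 5/6 in the next lemma.\<close>

lemma lf_far_below_qf:
  assumes "x \<le> 2 / 3"
  shows "lf 1 x + 9 / 400 \<le> qf 1 x"
proof -
  have "27 / 100 * (1 / 12) \<le> (gold - 1 - gold * A * (1 - mu)) * (3 / 4 - x)"
    using K2_ge assms by (intro mult_mono) auto
  then show ?thesis using lf_minus_qf[of 1 x] by (simp add: algebra_simps)
qed

lemma qf_far_below_lf:
  assumes "5 / 6 \<le> x"
  shows "qf 1 x + 9 / 400 \<le> lf 1 x"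
proof -
  have "27 / 100 * (1 / 12) \<le> (gold - 1 - gold * A * (1 - mu)) * (x - 3 / 4)"
    using K2_ge assms by (intro mult_mono) auto
  then show ?thesis using lf_minus_qf[of 1 x] by simp
qed

lemma psi_le: "psi u v \<le> lf u v" "psi u v \<le> pf u v" "psi u v \<le> qf u v"
  by (auto simp: psi_def)

text \<open>After a digit 1 the ratio \<open>v / u\<close> is at least 1/2, so only
  \<open>lf\<close> and \<open>qf\<close> compete; they stem from \<open>lf\<close> and
  \<open>pf\<close> before the digit.\<close>

lemma psi_one:
  assumes "0 \<le> x" "x \<le> 1"
  shows "psi (1 + x) 1 = gold * min (lf 1 x) (pf 1 x)"
proof -
  have "lf (1 + x) 1 \<le> pf (1 + x) 1" using assms by (intro lf_le_pf) simp
  then have "psi (1 + x) 1 = min (lf (1 + x) 1) (qf (1 + x) 1)" by (auto simp: psi_def)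
  also have "\<dots> = min (gold * lf 1 x) (gold * pf 1 x)" unfolding lf_one qf_one ..
  also have "\<dots> = gold * min (lf 1 x) (pf 1 x)" using gold_bounds by (simp add: min_mult_distrib_left)
  finally show ?thesis .
qed

text \<open>After a digit \<open>n\<close> the ratio is at most 1/5, where \<open>pf\<close> is the
  smallest form; it stems from \<open>qf\<close>.\<close>

lemma psi_n:
  assumes "0 \<le> x"
  shows "psi (real n + x) 1 = lam / gold * qf 1 x"
proof -
  have "pf (real n + x) 1 \<le> lf (real n + x) 1" using assms n_real by (intro pf_le_lf) simp
  moreover have "lf (real n + x) 1 \<le> qf (real n + x) 1" using assms n_real by (intro lf_le_qf) simp
  ultimately have "psi (real n + x) 1 = pf (real n + x) 1" by (simp add: psi_def)
  then show ?thesis using pf_n[of 1 x] by simp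
qed

lemma psi_pos: "0 \<le> x \<Longrightarrow> 0 < psi 1 x"
proof -
  assume x: "0 \<le> x"
  have "0 < lf 1 x" using x gold_bounds by (simp add: lf_def add_pos_nonneg)
  moreover have "0 < pf 1 x" using x mu_bounds A_bounds by (simp add: pf_def add_pos_nonneg)
  moreover have "0 < qf 1 x" using x mu_bounds A_bounds gold_bounds
    by (simp add: qf_def add_pos_nonneg)
  ultimately show ?thesis by (simp add: psi_def)
qed

lemma lf_le_gold:
  assumes "x \<le> 1"
  shows "lf 1 x \<le> gold"
proof -
  have "(gold - 1) * x \<le> (gold - 1) * 1" using assms gold_bounds by (intro mult_left_mono) auto
  then show ?thesis by (simp add: lf_def)
qed

lemma psi_le_gold: "x \<le> 1 \<Longrightarrow> psi 1 x \<le> gold"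
  using psi_le(1)[of 1 x] lf_le_gold[of x] by linarith

lemma psi_scale:
  assumes "0 < z"
  shows "z * psi 1 (1 / z) = psi z 1"
proof -
  have "z * lf 1 (1 / z) = lf z 1" "z * pf 1 (1 / z) = pf z 1" "z * qf 1 (1 / z) = qf z 1"
    using assms by (simp_all add: lf_def pf_def qf_def field_simps)
  then show ?thesis using assms by (simp add: psi_def min_mult_distrib_left)
qed

section \<open>Digit weights and the gain at a defect\<close>

definition beta :: real where "beta = (ln lam - 2 * ln gold) / (real n - 1)"
text \<open>Geometric interpolation between \<open>gold\<close> at 1 and \<open>lam / gold\<close>
  at \<open>n\<close>, so that a period of either regime has its exact growth as total
  weight.\<close>

definition weight :: "nat \<Rightarrow> real" where "weight a = gold * exp (beta * (real a - 1))"

lemma weight_1: "weight 1 = gold" by (simp add: weight_def)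

lemma beta_n: "beta * (real n - 1) = ln lam - 2 * ln gold"
  using n_real by (simp add: beta_def)

lemma exp_rate: "exp (ln lam - 2 * ln gold) = lam / (gold * gold)"
  using gold_bounds lam_bounds by (simp add: exp_diff exp_double power2_eq_square)

lemma weight_n: "weight n = lam / gold"
proof -
  have "weight n = gold * (lam / (gold * gold))"
    unfolding weight_def beta_n exp_rate ..
  then show ?thesis using gold_bounds by simp
qed

text \<open>
  If no step is a defect, the digits have period two: they are all \<open>1\<close>, or \<open>1\<close> and \<open>n\<close> alternate.
\<close>
definition defect :: "nat \<Rightarrow> real \<Rightarrow> bool" where
  "defect a x \<longleftrightarrow> 1 < a \<and> a < n \<or> a = n \<and> x \<le> 2 / 3 \<or> a = 1 \<and> real n / (real n + 1) \<le> x"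

text \<open>As \<open>psi\<close> is at most \<open>gold\<close>, an additive gap is a relative
  gain; the factor is the one that intermediate digits achieve.\<close>

lemma gain_const:
  assumes "0 \<le> x" "x \<le> 1" "psi 1 x + 9 / 400 \<le> y"
  shows "(1 + 1 / (80 * real n)) * psi 1 x \<le> y"
proof -
  have "1 / (80 * real n) * psi 1 x \<le> 1 / (80 * 5) * (13 / 8)"
    using n_real psi_le_gold[OF assms(2)] psi_pos[OF assms(1)] gold_bounds
    by (intro mult_mono frac_le) auto
  then show ?thesis using assms(3) by (simp add: distrib_right)
qed

text \<open>
  \<open>psi\<close> is concave and \<open>weight\<close> is log-affine, so intermediate digits gain strictly between the
  extreme ones.
\<close>
lemma psi_intermediate:
  assumes a: "1 < a" "a < n" and x: "0 \<le> x" "x \<le> 1"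
  shows "(1 + 1 / (80 * real n)) * (weight a * psi 1 x) \<le> psi (real a + x) 1"
proof -
  \<comment> \<open>The digit \<open>a\<close> is the mixture of 1 and \<open>n\<close> with share
    \<open>\<theta>\<close> of \<open>n\<close>; \<open>exp (2 * s)\<close> is the ratio of the
    weights of \<open>n\<close> and 1.\<close>
  define \<theta> where "\<theta> = (real a - 1) / (real n - 1)"
  define s where "s = (ln lam - 2 * ln gold) / 2"
  have N: "0 < real n - 1" using n_real by simp
  have \<theta>: "1 / real n \<le> \<theta>" "1 / real n \<le> 1 - \<theta>"
  proof -
    have "1 / real n \<le> 1 / (real n - 1)" using N by (simp add: frac_le)
    moreover have "1 / (real n - 1) \<le> \<theta>" unfolding \<theta>_def using a N by (intro divide_right_mono) auto
    moreover have "1 - \<theta> = (real n - real a) / (real n - 1)" using N by (simp add: \<theta>_def field_simps)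
    moreover have "1 / (real n - 1) \<le> (real n - real a) / (real n - 1)"
      using a N by (intro divide_right_mono) auto
    ultimately show "1 / real n \<le> \<theta>" "1 / real n \<le> 1 - \<theta>" by linarith+
  qed
  have \<theta>01: "0 \<le> \<theta>" "\<theta> \<le> 1" using \<theta> zero_le_divide_1_iff[of "real n"] by linarith+
  have es: "(exp s)\<^sup>2 = lam / (gold * gold)"
    unfolding exp_double[symmetric] exp_rate[symmetric] by (simp add: s_def)
  have "64 / 25 \<le> lam / (gold * gold)"
    unfolding gold_sq using gold_bounds lam_bounds by (simp add: field_simps)
  then have "(8 / 5)\<^sup>2 \<le> (exp s)\<^sup>2" unfolding es by (simp add: power2_eq_square)
  then have es_ge: "8 / 5 \<le> exp s" by (rule power2_le_imp_le) simp
  define e where "e = exp (\<theta> * (2 * s))"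
  have we: "weight a = gold * e"
  proof -
    have "2 * s = ln lam - 2 * ln gold" by (simp add: s_def)
    then show ?thesis unfolding weight_def e_def \<theta>_def beta_def by (simp add: mult.commute)
  qed
  have "exp 0 \<le> exp s" unfolding exp_zero using es_ge by linarith
  then have "0 \<le> s" unfolding exp_le_cancel_iff .
  then have "e \<le> exp (1 * (2 * s))" unfolding e_def using \<theta>01 by (simp add: mult_left_le_one_le)
  also have "\<dots> = (exp s)\<^sup>2" by (simp add: exp_double)
  finally have e_le: "e \<le> (exp s)\<^sup>2" .
  \<comment> \<open>As \<open>exp s \<ge> 8 / 5\<close>, \<open>(exp s - 1) / exp s\<close> is at
    least 3/8, and its square 9/64 exceeds 1/80.\<close>
  have "(exp s)\<^sup>2 * (1 / 80) \<le> (exp s - 1)\<^sup>2"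
  proof -
    have "(3 / 8 * exp s)\<^sup>2 \<le> (exp s - 1)\<^sup>2" using es_ge by (intro power_mono) auto
    then have "9 / 64 * (exp s)\<^sup>2 \<le> (exp s - 1)\<^sup>2" by (simp add: power_mult_distrib power2_eq_square)
    moreover have "0 \<le> (exp s)\<^sup>2" by simp
    ultimately show ?thesis by linarith
  qed
  then have "e * (1 / 80) \<le> (exp s - 1)\<^sup>2" using e_le by linarith
  then have "1 / real n * (e * (1 / 80)) \<le> 1 / real n * (exp s - 1)\<^sup>2" by (intro mult_left_mono) auto
  then have gap: "(1 + 1 / (80 * real n)) * e \<le> 1 - \<theta> + \<theta> * (exp s)\<^sup>2"
    using chord_gap[of "1 / real n" \<theta> s] \<theta> unfolding e_def by (simp add: distrib_right)
  have a_eq: "real a + x = (1 - \<theta>) * (1 + x) + \<theta> * (real n + x)"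
  proof -
    have "\<theta> * (real n - 1) = real a - 1" using N by (simp add: \<theta>_def)
    then show ?thesis by (simp add: algebra_simps)
  qed
  have lo: "(1 - \<theta>) * psi (1 + x) 1 + \<theta> * psi (real n + x) 1 \<le> (1 - \<theta>) * f (1 + x) 1 + \<theta> * f (real n + x) 1"
    if "\<And>u v. psi u v \<le> f u v" for f :: "real \<Rightarrow> real \<Rightarrow> real"
    using that \<theta>01 by (intro add_mono mult_left_mono) auto
  have "(1 - \<theta>) * lf (1 + x) 1 + \<theta> * lf (real n + x) 1 = lf (real a + x) 1"
    "(1 - \<theta>) * pf (1 + x) 1 + \<theta> * pf (real n + x) 1 = pf (real a + x) 1"
    "(1 - \<theta>) * qf (1 + x) 1 + \<theta> * qf (real n + x) 1 = qf (real a + x) 1"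
    unfolding a_eq lf_def pf_def qf_def by (simp_all add: algebra_simps)
  then have concave: "(1 - \<theta>) * psi (1 + x) 1 + \<theta> * psi (real n + x) 1 \<le> psi (real a + x) 1"
    unfolding psi_def[of "real a + x"] using lo[OF psi_le(1)] lo[OF psi_le(2)] lo[OF psi_le(3)] by simp
  have p1: "gold * psi 1 x \<le> psi (1 + x) 1"
    unfolding psi_one[OF x] using gold_bounds by (intro mult_left_mono) (auto simp: psi_def)
  have "lam / gold * psi 1 x \<le> psi (real n + x) 1"
    unfolding psi_n[OF x(1)] using gold_bounds lam_bounds by (intro mult_left_mono) (auto simp: psi_def)
  then have pn: "gold * (exp s)\<^sup>2 * psi 1 x \<le> psi (real n + x) 1"
    unfolding es using gold_bounds by simp
  have "(1 + 1 / (80 * real n)) * (weight a * psi 1 x) = ((1 + 1 / (80 * real n)) * e) * (gold * psi 1 x)"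
    by (simp add: we)
  also have "\<dots> \<le> (1 - \<theta> + \<theta> * (exp s)\<^sup>2) * (gold * psi 1 x)"
    using gap psi_pos[OF x(1)] gold_bounds by (intro mult_right_mono) auto
  also have "\<dots> = (1 - \<theta>) * (gold * psi 1 x) + \<theta> * (gold * (exp s)\<^sup>2 * psi 1 x)"
    by (simp add: algebra_simps)
  also have "\<dots> \<le> (1 - \<theta>) * psi (1 + x) 1 + \<theta> * psi (real n + x) 1"
    using p1 pn \<theta>01 by (intro add_mono mult_left_mono) auto
  finally show ?thesis using concave by linarith
qed

text \<open>By \<open>psi_n\<close> and \<open>psi_one\<close> the new value depends on
  \<open>qf\<close> alone, or on \<open>lf\<close> and \<open>pf\<close> alone. At a defect another
  form, \<open>lf\<close> or \<open>qf\<close> respectively, is smaller by a fixed gap and bounds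
  \<open>psi 1 x\<close>.\<close>

lemma psi_defect:
  assumes d: "defect a x" and x: "0 \<le> x" "x \<le> 1"
  shows "(1 + 1 / (80 * real n)) * (weight a * psi 1 x) \<le> psi (real a + x) 1"
  using d unfolding defect_def
proof (elim disjE conjE)
  assume "1 < a" "a < n"
  then show ?thesis using x by (rule psi_intermediate)
next
  assume a: "a = n" and x23: "x \<le> 2 / 3"
  have "(1 + 1 / (80 * real n)) * psi 1 x \<le> qf 1 x"
    using lf_far_below_qf[OF x23] by (intro gain_const[OF x]) (simp add: psi_def)
  then have "lam / gold * ((1 + 1 / (80 * real n)) * psi 1 x) \<le> lam / gold * qf 1 x"
    using gold_bounds lam_bounds by (intro mult_left_mono) auto
  then show ?thesis unfolding a weight_n psi_n[OF x(1)] by (simp add: mult.left_commute)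
next
  assume a: "a = 1" and xn: "real n / (real n + 1) \<le> x"
  have "5 / 6 \<le> real n / (real n + 1)" using n_real by (simp add: field_simps)
  with xn have x56: "5 / 6 \<le> x" by linarith
  have "lf 1 x \<le> pf 1 x" using x56 by (intro lf_le_pf) simp
  then have "(1 + 1 / (80 * real n)) * psi 1 x \<le> min (lf 1 x) (pf 1 x)"
    using qf_far_below_lf[OF x56] by (intro gain_const[OF x]) (simp add: psi_def)
  then have "gold * ((1 + 1 / (80 * real n)) * psi 1 x) \<le> gold * min (lf 1 x) (pf 1 x)"
    using gold_bounds by (intro mult_left_mono) auto
  then show ?thesis unfolding a weight_1 of_nat_1 psi_one[OF x] by (simp only: mult.left_commute)
qed

lemma psi_step:
  assumes a: "1 \<le> a" "a \<le> n" and x: "0 \<le> x" "x \<le> 1"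
  shows "weight a * psi 1 x \<le> psi (real a + x) 1"
proof (cases "a = 1 \<or> a = n")
  case True
  then show ?thesis
  proof
    assume "a = 1"
    then show ?thesis unfolding \<open>a = 1\<close> weight_1 of_nat_1 psi_one[OF x]
      using gold_bounds by (intro mult_left_mono) (auto simp: psi_def)
  next
    assume "a = n"
    then show ?thesis unfolding \<open>a = n\<close> weight_n psi_n[OF x(1)]
      using gold_bounds lam_bounds by (intro mult_left_mono) (auto simp: psi_def)
  qed
next
  case False
  then have "defect a x" using a by (auto simp: defect_def)
  from psi_defect[OF this x] have "(1 + 1 / (80 * real n)) * (weight a * psi 1 x) \<le> psi (real a + x) 1" .
  moreover have "1 * (weight a * psi 1 x) \<le> (1 + 1 / (80 * real n)) * (weight a * psi 1 x)"
    using psi_pos[OF x(1)] gold_bounds by (intro mult_right_mono) (auto simp: weight_def)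
  ultimately show ?thesis by simp
qed

text \<open>The logarithm of the potential divided by the product of the weights of the first
  \<open>t\<close> digits.\<close>

definition height :: "(nat \<Rightarrow> nat) \<Rightarrow> nat \<Rightarrow> real" where
  "height a t = ln (den a t * psi 1 (past a t)) - ln gold * real t - beta * (real (digsum a t) - real t)"

lemma height_Suc:
  assumes dig: "digits a n" and c: "1 \<le> c"
    and step: "c * (weight (a (Suc t)) * psi 1 (past a t)) \<le> psi (real (a (Suc t)) + past a t) 1"
  shows "height a t + ln c \<le> height a (Suc t)"
proof -
  let ?a = "a (Suc t)" and ?x = "past a t"
  have x: "0 \<le> ?x" "?x \<le> 1" using past_bounds[OF dig] by auto
  have z: "0 < real ?a + ?x" using x digitsD(3)[OF dig, of t] by simp
  have dpos: "0 < den a t" using den_mono_step(1)[OF dig, of t] by simp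
  have w: "0 < weight ?a" unfolding weight_def using gold_bounds by simp
  have p: "0 < psi 1 ?x" by (rule psi_pos[OF x(1)])
  \<comment> \<open>\<open>psi\<close> is homogeneous, so the factor \<open>real ?a + ?x\<close> of
    the new denominator moves into its arguments.\<close>
  have "den a (Suc t) * psi 1 (past a (Suc t)) = den a t * psi (real ?a + ?x) 1"
    using psi_scale[OF z] by (simp add: mult.assoc mult.left_commute)
  then have "ln (c * weight ?a * (den a t * psi 1 ?x)) \<le> ln (den a (Suc t) * psi 1 (past a (Suc t)))"
    using c w p dpos mult_left_mono[OF step, of "den a t"]
    by (intro ln_mono) (simp_all add: ac_simps)
  moreover have "ln (c * weight ?a * (den a t * psi 1 ?x)) = ln c + ln (weight ?a) + ln (den a t * psi 1 ?x)"
    using c w p dpos by (simp add: ln_mult)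
  moreover have "ln (weight ?a) = ln gold + beta * (real ?a - 1)"
    unfolding weight_def using gold_bounds by (simp add: ln_mult)
  ultimately show ?thesis unfolding height_def by (simp add: algebra_simps del: den.simps past.simps)
qed

lemma height_mono_step: "digits a n \<Longrightarrow> height a t \<le> height a (Suc t)"
  using height_Suc[of a 1 t] psi_step[of "a (Suc t)" "past a t"] digitsD(1,2) past_bounds by simp

lemma height_mono: "digits a n \<Longrightarrow> s \<le> t \<Longrightarrow> height a s \<le> height a t"
  by (rule lift_Suc_mono_le[of "height a"]) (use height_mono_step in blast)

lemma height_defect:
  "digits a n \<Longrightarrow> defect (a (Suc t)) (past a t) \<Longrightarrow>
    height a t + ln (1 + 1 / (80 * real n)) \<le> height a (Suc t)"
  by (rule height_Suc) (auto intro: psi_defect past_bounds)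


subsection \<open>The constant\<close>

text \<open>Net effect of one unit of digit sum: half of \<open>ln 2\<close> from the derivative
  criterion, minus \<open>beta\<close> from the weights.\<close>

definition gam :: real where "gam = ln (sqrt 2) - beta"

lemma ln_sqrt_2: "ln (sqrt 2) = ln 2 / (2 :: real)"
  by (simp add: ln_sqrt)

text \<open>The tangent of \<open>ln\<close> at 7, that is at \<open>n = 5\<close>: later estimates
  become linear in \<open>n\<close> and reduce to the case \<open>n = 5\<close> and a slope.\<close>

lemma ln_lam_le: "ln lam \<le> ln 7 + (real n - 5) / 7"
proof -
  have "ln lam \<le> ln (real n + 2)" using lam_bounds by (intro ln_mono) auto
  also have "\<dots> = ln 7 + ln ((real n + 2) / 7)" by (simp add: ln_div)
  also have "ln ((real n + 2) / 7) \<le> (real n + 2) / 7 - 1" by (rule ln_le_minus_one) simp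
  finally show ?thesis by (simp add: diff_divide_distrib add_divide_distrib)
qed

lemma gold_gt_sqrt_2: "1 / 10 \<le> ln gold - ln (sqrt 2)"
proof -
  have "1 / (gold * gold / 2) \<le> 1 / (64 / 25 / 2)"
    unfolding gold_sq using gold_bounds by (intro divide_left_mono) auto
  then have "1 / 5 \<le> 1 - 1 / (gold * gold / 2)" by simp
  also have "\<dots> \<le> ln (gold * gold / 2)" using gold_bounds by (intro ln_ge_one_minus) auto
  also have "\<dots> = 2 * ln gold - ln 2" using gold_bounds by (simp add: ln_div ln_mult)
  finally show ?thesis unfolding ln_sqrt_2 by simp
qed

text \<open>Decides the extremal construction: a block costs \<open>ln gold\<close> and gains 1/2 on
  the logarithmic scale.\<close>

lemma ln_gold_less: "ln gold < 1 / 2"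
proof -
  have "1 + 1 / 2 + (1 / 2)\<^sup>2 / 2 \<le> exp (1 / 2 :: real)" by (rule exp_lower_Taylor_quadratic) simp
  moreover have "gold < 13 / 8"
  proof -
    have "sqrt 5 < 9 / 4" by (rule real_less_lsqrt) (simp_all add: power2_eq_square)
    then show ?thesis by (simp add: gold_def)
  qed
  ultimately have "gold < exp (1 / 2)" by (simp add: power2_eq_square)
  then show ?thesis using gold_bounds by (metis exp_less_cancel_iff exp_ln less_le_trans zero_less_divide_iff zero_less_numeral)
qed

lemma ln_gold_pos: "0 < ln gold"
  using gold_bounds by (intro ln_gt_zero) auto

lemma beta_nonneg: "0 \<le> beta"
proof -
  have "gold * gold \<le> lam" unfolding gold_sq using gold_bounds lam_bounds by linarith
  then have "ln (gold * gold) \<le> ln lam" using gold_bounds by (intro ln_mono) auto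
  then have "0 \<le> ln lam - 2 * ln gold" using gold_bounds by (simp add: ln_mult)
  then show ?thesis unfolding beta_def using n_real by simp
qed

lemma gam_bounds: "1 / 20 \<le> gam" "gam \<le> 1 / 2"
proof -
  have "2 / 3 \<le> ln (2 :: real)" by (rule ln2_ge_two_thirds)
  then have l: "1 / 3 \<le> ln (sqrt 2)" unfolding ln_sqrt_2 by simp
  have N: "0 < real n - 1" using n_real by simp
  \<comment> \<open>Times \<open>n - 1\<close>, the lower bound is linear in \<open>n\<close> after
    \<open>ln_lam_le\<close>; this is the case \<open>n = 5\<close>, where
    \<open>(n - 1) / 20 = 1 / 5\<close>.\<close>
  have "2 * ln gold + 2 * ln 2 - ln 7 = ln (4 * (gold * gold) / 7)"
    using gold_bounds ln_realpow[of 2 2] by (simp add: ln_div ln_mult)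
  moreover have "1 - 1 / (4 * (gold * gold) / 7) \<le> ln (4 * (gold * gold) / 7)"
    using gold_bounds by (intro ln_ge_one_minus) auto
  moreover have "1 / (4 * (gold * gold) / 7) \<le> 1 / (4 * (64 / 25) / 7)"
    unfolding gold_sq using gold_bounds by (intro divide_left_mono) auto
  ultimately have base: "1 / 5 \<le> 2 * ln gold + 4 * ln (sqrt 2) - ln 7" unfolding ln_sqrt_2 by simp
  have "0 \<le> (real n - 5) * (ln (sqrt 2) - 1 / 20 - 1 / 7)" using n_real l by (intro mult_nonneg_nonneg) auto
  then have "1 / 20 * (real n - 1) \<le> ln (sqrt 2) * (real n - 1) - (ln lam - 2 * ln gold)"
    using base ln_lam_le by (simp add: algebra_simps diff_divide_distrib)
  also have "\<dots> = gam * (real n - 1)" unfolding gam_def left_diff_distrib beta_n ..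
  finally show "1 / 20 \<le> gam" using N mult_le_cancel_right_pos by blast
  have "ln (2 :: real) \<le> 1" using ln_le_minus_one[of 2] by simp
  then show "gam \<le> 1 / 2" using beta_nonneg unfolding gam_def ln_sqrt_2 by simp
qed

text \<open>The origin of \<open>kappa n\<close>: at this average digit the product of the weights
  grows exactly like \<open>sqrt 2\<close> to the digit sum.\<close>

lemma gam_kappa: "gam * kappa n = ln gold - beta"
proof -
  have lam: "(real n + 2 + sqrt (real n ^ 2 + 4 * real n)) / 2 = lam"
    by (simp add: lam_def mu_def field_simps)
  have N: "real n - 1 \<noteq> 0" "gam \<noteq> 0" using n_real gam_bounds by auto
  have den: "(real n - 1) * ln (sqrt 2) - ln lam + 2 * ln gold = (real n - 1) * gam"
    unfolding gam_def right_diff_distrib using beta_n by (simp add: mult.commute)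
  have "(real n + 1) * ln gold - ln lam = (real n - 1) * (ln gold - beta)"
    using beta_n by (simp add: algebra_simps)
  then have "kappa n = (real n - 1) * (ln gold - beta) / ((real n - 1) * gam)"
    unfolding kappa_def lam gold_def[symmetric] den by simp
  then show ?thesis using N by simp
qed

text \<open>With \<open>kappa_less\<close>: the averages 1 and \<open>(n + 1) / 2\<close> of the two
  regimes lie on opposite sides of \<open>kappa n\<close>, so both drift linearly. Here the reason
  is \<open>gold > sqrt 2\<close>.\<close>

lemma kappa_gt_1: "1 / 8 \<le> kappa n - 1"
proof -
  have "1 / 10 \<le> gam * (kappa n - 1)"
    using gam_kappa gold_gt_sqrt_2 by (simp add: gam_def algebra_simps)
  moreover have "gam * (kappa n - 1) < gam * (1 / 8)" if "kappa n - 1 < 1 / 8"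
    using that gam_bounds by (intro mult_strict_left_mono) auto
  ultimately show ?thesis using gam_bounds by linarith
qed

text \<open>A period \<open>1, n\<close> multiplies continuants by \<open>lam\<close>, which is less
  than \<open>sqrt 2 ^ (n + 1)\<close>; at \<open>n = 5\<close> this is
  \<open>lam \<le> 7 < 8\<close>.\<close>

lemma kappa_less: "1 / 8 \<le> (real n + 1) / 2 - kappa n"
proof -
  have "1 - 1 / (8 / 7) \<le> ln (8 / 7 :: real)" by (rule ln_ge_one_minus) simp
  then have "1 / 8 \<le> 3 * ln 2 - ln (7 :: real)" using ln_realpow[of 2 3] by (simp add: ln_div)
  moreover have "1 / 3 \<le> ln (sqrt 2)" unfolding ln_sqrt_2 using ln2_ge_two_thirds by simp
  then have "0 \<le> (real n - 5) * (ln (sqrt 2) - 1 / 7)" using n_real by (intro mult_nonneg_nonneg) auto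
  ultimately have "1 / 8 \<le> (real n + 1) * ln (sqrt 2) - ln lam"
    using ln_lam_le unfolding ln_sqrt_2 by (simp add: algebra_simps diff_divide_distrib)
  also have "\<dots> = 2 * (gam * ((real n + 1) / 2 - kappa n))"
  proof -
    have "2 * (gam * ((real n + 1) / 2 - kappa n)) = gam * (real n + 1) - 2 * (ln gold - beta)"
      unfolding gam_kappa[symmetric] by (simp add: field_simps)
    also have "\<dots> = (real n + 1) * ln (sqrt 2) - (beta * (real n - 1) + 2 * ln gold)"
      by (simp add: gam_def algebra_simps)
    finally show ?thesis unfolding beta_n by simp
  qed
  finally have "1 / 16 \<le> gam * ((real n + 1) / 2 - kappa n)" by simp
  moreover have "gam * ((real n + 1) / 2 - kappa n) < gam * (1 / 8)" if "(real n + 1) / 2 - kappa n < 1 / 8"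
    using that gam_bounds by (intro mult_strict_left_mono) auto
  ultimately show ?thesis using gam_bounds by linarith
qed

definition excess :: "(nat \<Rightarrow> nat) \<Rightarrow> nat \<Rightarrow> real" where
  "excess a t = real (digsum a t) - kappa n * real t"

text \<open>Links the derivative criterion to \<open>height\<close>: the subtracted term is the
  logarithm of the product of the weights.\<close>

lemma gam_excess:
  "gam * excess a t = real (digsum a t) * ln (sqrt 2) - (ln gold * real t + beta * (real (digsum a t) - real t))"
proof -
  have "gam * excess a t = gam * real (digsum a t) - (gam * kappa n) * real t"
    by (simp add: excess_def algebra_simps)
  then show ?thesis unfolding gam_kappa by (simp add: gam_def algebra_simps)
qed

subsection \<open>The lower bound\<close>

text \<open>The thresholds in \<open>defect\<close> fit the ratio \<open>past\<close>: it is at most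
  \<open>1 / n\<close> after \<open>n\<close>, at least \<open>n / (n + 1)\<close> after
  \<open>n, 1\<close>, and at most 2/3 after \<open>1, 1\<close>. So \<open>n, n\<close> and
  \<open>n, 1, 1\<close> and \<open>1, 1, n\<close> all contain a defect.\<close>

lemma no_defect_periodic:
  assumes dig: "digits a n"
    and nd: "\<not> defect (a (Suc t)) (past a t)" "\<not> defect (a (Suc (Suc t))) (past a (Suc t))"
      "\<not> defect (a (Suc (Suc (Suc t)))) (past a (Suc (Suc t)))"
  shows "a (Suc t) + a (Suc (Suc t)) \<in> {2, n + 1}" "a (Suc (Suc (Suc t))) = a (Suc t)"
proof -
  have x: "0 \<le> past a s" "past a s \<le> 1" for s using past_bounds[OF dig] by auto
  have ones: "a (Suc s) = 1 \<or> a (Suc s) = n" if "\<not> defect (a (Suc s)) (past a s)" for s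
    using that digitsD(1,2)[OF dig, of s] unfolding defect_def by linarith
  have after_n: "past a (Suc s) \<le> 1 / real n" if "a (Suc s) = n" for s
    using that x(1)[of s] n_real by (simp add: frac_le)
  have n5': "1 / real n \<le> 1 / 5" using n_real by (simp add: frac_le)
  have not_n: "a (Suc (Suc s)) \<noteq> n" if "a (Suc s) = n" "\<not> defect (a (Suc (Suc s))) (past a (Suc s))" for s
    using after_n[OF that(1)] n5' that(2) unfolding defect_def by linarith
  have n_1: "past a (Suc (Suc s)) \<ge> real n / (real n + 1)" if "a (Suc s) = n" "a (Suc (Suc s)) = 1" for s
  proof -
    have "1 / (1 + 1 / real n) \<le> 1 / (1 + past a (Suc s))"
      using after_n[OF that(1)] x(1)[of "Suc s"] by (intro divide_left_mono mult_pos_pos) (auto simp: add_pos_nonneg)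
    moreover have "1 / (1 + 1 / real n) = real n / (real n + 1)" using n_real by (simp add: field_simps)
    ultimately show ?thesis unfolding past.simps(2)[of a "Suc s"] that(2) by simp
  qed
  have one_1: "past a (Suc (Suc s)) \<le> 2 / 3" if "a (Suc s) = 1" "a (Suc (Suc s)) = 1" for s
  proof -
    have "1 / 2 \<le> past a (Suc s)" using that(1) x[of s] by (simp add: field_simps)
    then have "1 / (1 + past a (Suc s)) \<le> 1 / (1 + 1 / 2)" by (intro frac_le) auto
    then show ?thesis unfolding past.simps(2)[of a "Suc s"] that(2) by simp
  qed
  show "a (Suc t) + a (Suc (Suc t)) \<in> {2, n + 1}"
    using ones[OF nd(1)] ones[OF nd(2)] not_n[OF _ nd(2)] by auto
  show "a (Suc (Suc (Suc t))) = a (Suc t)"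
  proof (cases "a (Suc (Suc t)) = n")
    case True
    then show ?thesis using ones[OF nd(1)] ones[OF nd(3)] not_n[OF _ nd(2)] not_n[OF _ nd(3)] by auto
  next
    case False
    then have 1: "a (Suc (Suc t)) = 1" using ones[OF nd(2)] by simp
    show ?thesis
    proof (cases "a (Suc t) = n")
      case True
      have "a (Suc (Suc (Suc t))) \<noteq> 1" using nd(3) n_1[OF True 1] unfolding defect_def by blast
      then show ?thesis using True ones[OF nd(3)] by simp
    next
      case False
      then have 11: "a (Suc t) = 1" using ones[OF nd(1)] by simp
      have "a (Suc (Suc (Suc t))) \<noteq> n" using nd(3) one_1[OF 11 1] unfolding defect_def by blast
      then show ?thesis using 11 ones[OF nd(3)] by simp
    qed
  qed
qed

text \<open>The digits have period two with sum 2 or \<open>n + 1\<close>, and both differ from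
  \<open>2 * kappa n\<close> by at least 1/4.\<close>

lemma no_defect_excess:
  assumes dig: "digits a n"
    and nd: "\<And>j. s \<le> j \<Longrightarrow> j \<le> s + 2 * m \<Longrightarrow> \<not> defect (a (Suc j)) (past a j)"
  shows "real m / 4 \<le> \<bar>excess a (s + 2 * m) - excess a s\<bar>"
proof (cases "m = 0")
  case False
  let ?p = "a (Suc s) + a (Suc (Suc s))"
  have per: "a (Suc (s + 2 * i)) = a (Suc s) \<and> a (Suc (Suc (s + 2 * i))) = a (Suc (Suc s))" if "i < m" for i
    using that
  proof (induction i)
    case (Suc i)
    have "\<not> defect (a (Suc (s + 2 * i))) (past a (s + 2 * i))"
      "\<not> defect (a (Suc (Suc (s + 2 * i)))) (past a (Suc (s + 2 * i)))"
      "\<not> defect (a (Suc (Suc (Suc (s + 2 * i))))) (past a (Suc (Suc (s + 2 * i))))"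
      "\<not> defect (a (Suc (Suc (Suc (Suc (s + 2 * i)))))) (past a (Suc (Suc (Suc (s + 2 * i)))))"
      by (rule nd; use Suc.prems in linarith)+
    from no_defect_periodic(2)[OF dig this(1-3)] no_defect_periodic(2)[OF dig this(2-4)]
    show ?case using Suc by simp
  qed simp
  have sum: "digsum a (s + 2 * i) = digsum a s + i * ?p" if "i \<le> m" for i
    using that
  proof (induction i)
    case (Suc i)
    then show ?case using per[of i] by simp
  qed simp
  have "\<not> defect (a (Suc s)) (past a s)" "\<not> defect (a (Suc (Suc s))) (past a (Suc s))"
    "\<not> defect (a (Suc (Suc (Suc s)))) (past a (Suc (Suc s)))" by (rule nd; use False in linarith)+
  from no_defect_periodic(1)[OF dig this] have p: "?p = 2 \<or> ?p = n + 1" by simp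
  have "excess a (s + 2 * m) - excess a s = real m * (real ?p - 2 * kappa n)"
    unfolding excess_def sum[OF order_refl] by (simp add: algebra_simps)
  moreover have "1 / 4 \<le> \<bar>real ?p - 2 * kappa n\<bar>"
    using p
  proof
    assume "?p = 2"
    then show ?thesis using kappa_gt_1 unfolding \<open>?p = 2\<close> by simp
  next
    assume "?p = n + 1"
    have "1 / 4 \<le> real n + 1 - 2 * kappa n" using kappa_less unfolding add_divide_distrib by linarith
    then show ?thesis unfolding \<open>?p = n + 1\<close> by simp
  qed
  then have "real m * (1 / 4) \<le> real m * \<bar>real ?p - 2 * kappa n\<bar>" by (intro mult_left_mono) auto
  ultimately show ?thesis by (simp add: abs_mult)
qed simp

text \<open>Every window contains a defect, since otherwise the excess would move by at least
  \<open>m / 4 > M\<close>.\<close>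

lemma height_windows:
  assumes dig: "digits a n"
    and bd: "\<And>u. u0 \<le> u \<Longrightarrow> u \<le> t \<Longrightarrow> 0 \<le> excess a u \<and> excess a u \<le> M"
    and m: "4 * M < real m"
  shows "u0 + k * (2 * m + 1) \<le> t \<Longrightarrow>
    height a u0 + real k * ln (1 + 1 / (80 * real n)) \<le> height a (u0 + k * (2 * m + 1))"
proof (induction k)
  case (Suc k)
  let ?s = "u0 + k * (2 * m + 1)"
  \<comment> \<open>The window tests the positions \<open>?s\<close> to \<open>?s + 2 * m\<close>; a
    defect at \<open>j\<close> shows in the height at \<open>Suc j\<close>, hence the length
    \<open>2 * m + 1\<close>.\<close>
  have e: "u0 + Suc k * (2 * m + 1) = Suc (?s + 2 * m)" by simp
  have le: "Suc (?s + 2 * m) \<le> t" using Suc.prems unfolding e .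
  have "\<exists>j. ?s \<le> j \<and> j \<le> ?s + 2 * m \<and> defect (a (Suc j)) (past a j)"
  proof (rule ccontr)
    assume "\<not> ?thesis"
    then have "real m / 4 \<le> \<bar>excess a (?s + 2 * m) - excess a ?s\<bar>"
      by (intro no_defect_excess[OF dig]) blast
    moreover have "\<bar>excess a (?s + 2 * m) - excess a ?s\<bar> \<le> M"
      using bd[of ?s] bd[of "?s + 2 * m"] le by (simp add: abs_le_iff)
    ultimately show False using m by linarith
  qed
  then obtain j where j: "?s \<le> j" "j \<le> ?s + 2 * m" "defect (a (Suc j)) (past a j)" by blast
  have "height a ?s + ln (1 + 1 / (80 * real n)) \<le> height a (Suc j)"
    using height_defect[OF dig j(3)] height_mono[OF dig j(1)] by linarith
  also have "\<dots> \<le> height a (Suc (?s + 2 * m))" using j(2) by (intro height_mono[OF dig]) simp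
  finally have "height a ?s + ln (1 + 1 / (80 * real n)) \<le> height a (u0 + Suc k * (2 * m + 1))" unfolding e .
  moreover have "height a u0 + real k * ln (1 + 1 / (80 * real n)) \<le> height a ?s"
    using Suc.IH le by simp
  ultimately show ?case by (simp add: distrib_right del: mult_Suc)
qed simp

text \<open>The \<open>k\<close> complete windows raise the height by at least
  \<open>k / (81 * n)\<close>, but it rises by at most \<open>gam * M \<le> M / 2\<close>; so
  \<open>k \<le> 41 * n * M\<close>, and each window has length at most
  \<open>8 * M + 3\<close>.\<close>

lemma length_le:
  assumes dig: "digits a n" and "u0 \<le> t" and M: "0 \<le> M"
    and bd: "\<And>u. u0 \<le> u \<Longrightarrow> u \<le> t \<Longrightarrow> 0 \<le> excess a u \<and> excess a u \<le> M"
    and h: "height a t - height a 0 \<le> gam * excess a t"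
  shows "real t \<le> real u0 + (41 * real n * M + 1) * (8 * M + 3)"
proof -
  define c where "c = ln (1 + 1 / (80 * real n))"
  define m where "m = Suc (nat \<lfloor>4 * M\<rfloor>)"
  define w where "w = 2 * m + 1"
  define k where "k = (t - u0) div w"
  have m: "4 * M < real m" "real m \<le> 4 * M + 1" unfolding m_def using M by linarith+
  have w: "real w \<le> 8 * M + 3" "0 < w" unfolding w_def using m by auto
  have "u0 + k * w \<le> t" using \<open>u0 \<le> t\<close> div_times_less_eq_dividend[of "t - u0" w] unfolding k_def by linarith
  then have "height a u0 + real k * c \<le> height a (u0 + k * w)" "height a (u0 + k * w) \<le> height a t"
    unfolding w_def c_def by (intro height_windows[OF dig bd m(1)] height_mono[OF dig]; simp)+
  moreover have "height a 0 \<le> height a u0" by (rule height_mono[OF dig]) simp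
  moreover have "gam * excess a t \<le> 1 / 2 * M"
    using gam_bounds bd[OF \<open>u0 \<le> t\<close> order_refl] by (intro mult_mono) auto
  ultimately have kc: "real k * c \<le> M / 2" using h by linarith
  have "1 / (81 * real n) \<le> 1 / (80 * real n + 1)" using n_real by (intro frac_le) auto
  also have "\<dots> = 1 - 1 / (1 + 1 / (80 * real n))" using n_real by (simp add: field_simps)
  also have "\<dots> \<le> c" unfolding c_def by (rule ln_ge_one_minus) (simp add: add_pos_nonneg)
  finally have "real k * (1 / (81 * real n)) \<le> M / 2" using kc
    by (meson mult_left_mono of_nat_0_le_iff order_trans)
  then have "real k \<le> M / 2 * (81 * real n)" using n_real by (simp add: field_simps)
  also have "\<dots> \<le> 41 * real n * M" using M n_real by simp
  finally have k: "real k \<le> 41 * real n * M" .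
  have "t - u0 \<le> (k + 1) * w" unfolding k_def using dividend_less_div_times[OF w(2), of "t - u0"] by simp
  then have "real (t - u0) \<le> real ((k + 1) * w)" by (rule of_nat_mono)
  also have "\<dots> = (real k + 1) * real w" by (simp add: algebra_simps)
  also have "\<dots> \<le> (41 * real n * M + 1) * (8 * M + 3)" using k w M by (intro mult_mono) auto
  finally show ?thesis using \<open>u0 \<le> t\<close> by (simp add: of_nat_diff)
qed

lemma max_excess_ge:
  assumes x: "x \<in> E n" and deriv: "(question_mark has_real_derivative 0) (at x)"
  shows "\<forall>\<^sub>F t in sequentially.
    Max ((\<lambda>u. real (S x u) - kappa n * real u) ` {1..t}) \<ge> sqrt (real t) / (160 * (real n + 2) ^ 10)"
proof -
  let ?a = "pquot x"
  have dig: "digits ?a n" by (rule E_digits[OF x])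
  define b where "b = height ?a 0"
  have "(\<lambda>t. (den ?a t)\<^sup>2 / 2 ^ S x t) \<longlonglongrightarrow> 0" by (rule question_mark_deriv_zeroD[OF x deriv])
  \<comment> \<open>With this threshold the summand -1/2 in the logarithm of \<open>den\<close>
    absorbs the bound \<open>ln gold < 1 / 2\<close> for the logarithm of
    \<open>psi\<close>.\<close>
  then have "\<forall>\<^sub>F t in sequentially. (den ?a t)\<^sup>2 / 2 ^ S x t < exp (2 * b - 1)"
    by (rule order_tendstoD) simp
  then obtain u1 where u1: "\<And>t. u1 \<le> t \<Longrightarrow> (den ?a t)\<^sup>2 / 2 ^ S x t < exp (2 * b - 1)"
    unfolding eventually_sequentially by blast
  define u0 where "u0 = max u1 1"
  have h: "height ?a t - b \<le> gam * excess ?a t" if "u0 \<le> t" for t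
  proof -
    have dpos: "0 < den ?a t" using den_mono_step(1)[OF dig, of t] by simp
    have p: "0 < psi 1 (past ?a t)" "psi 1 (past ?a t) \<le> gold"
      using psi_pos psi_le_gold past_bounds[OF dig] by auto
    have "ln ((den ?a t)\<^sup>2 / 2 ^ S x t) \<le> ln (exp (2 * b - 1))"
      using u1[of t] that dpos unfolding u0_def by (intro ln_mono) auto
    then have "2 * ln (den ?a t) - real (S x t) * ln 2 \<le> 2 * b - 1"
      using dpos by (simp add: ln_div ln_realpow)
    then have "ln (den ?a t) \<le> real (digsum ?a t) * ln (sqrt 2) + b - 1 / 2"
      unfolding ln_sqrt_2 S_eq_digsum by simp
    moreover have "ln (psi 1 (past ?a t)) \<le> ln gold" using p by (intro ln_mono) auto
    moreover have "ln (den ?a t * psi 1 (past ?a t)) = ln (den ?a t) + ln (psi 1 (past ?a t))"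
      using dpos p by (simp add: ln_mult)
    ultimately show ?thesis unfolding gam_excess height_def using ln_gold_less by simp
  qed
  have ex0: "0 \<le> excess ?a t" if "u0 \<le> t" for t
  proof -
    have "0 \<le> gam * excess ?a t"
      using h[OF that] height_mono[OF dig, of 0 t] unfolding b_def by linarith
    then show ?thesis using gam_bounds by (simp add: zero_le_mult_iff)
  qed
  have "sqrt (real t) / (160 * (real n + 2) ^ 10) \<le> Max ((\<lambda>u. real (S x u) - kappa n * real u) ` {1..t})"
    if t: "(4 + u0)\<^sup>2 \<le> t" for t
  proof (rule ccontr)
    define M where "M = Max ((\<lambda>u. real (S x u) - kappa n * real u) ` {1..t})"
    define s where "s = sqrt (real t)"
    assume "\<not> ?thesis"
    then have less: "M < s / (160 * (real n + 2) ^ 10)" unfolding M_def s_def by simp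
    have "4 + u0 \<le> (4 + u0) * (4 + u0)" by simp
    then have u0t: "u0 \<le> t" using t unfolding power2_eq_square by linarith
    have "real ((4 + u0)\<^sup>2) \<le> real t" using t by (rule of_nat_mono)
    then have s: "4 + real u0 \<le> s" unfolding s_def by (intro real_le_rsqrt) simp
    have bd: "0 \<le> excess ?a u \<and> excess ?a u \<le> M" if u: "u0 \<le> u" "u \<le> t" for u
    proof -
      have "u \<in> {1..t}" using u unfolding u0_def by simp
      then have "real (S x u) - kappa n * real u \<le> M" unfolding M_def by (intro Max_ge) auto
      then show ?thesis using ex0[OF u(1)] by (simp add: excess_def S_eq_digsum)
    qed
    have M0: "0 \<le> M" using bd[OF u0t order_refl] by linarith
    have "(real n + 2) ^ 1 \<le> (real n + 2) ^ 10" by (rule power_increasing) auto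
    then have np: "real n + 2 \<le> (real n + 2) ^ 10" by simp
    have "M * (160 * (real n + 2)) \<le> M * (160 * (real n + 2) ^ 10)"
      using M0 np by (intro mult_left_mono) auto
    also have "\<dots> \<le> s" using less np n_real by (simp add: pos_less_divide_eq)
    finally have nM: "160 * (real n * M) + 320 * M \<le> s" by (simp add: algebra_simps)
    have nM0: "0 \<le> real n * M" using M0 by simp
    have "real t \<le> real u0 + (41 * real n * M + 1) * (8 * M + 3)"
      using length_le[OF dig u0t M0 bd] h[OF u0t] unfolding b_def by blast
    \<comment> \<open>The right-hand side has leading term \<open>s * s / 8\<close>, while the
      left-hand side is \<open>s * s\<close>; \<open>s \<ge> 4 + u0\<close> disposes of the
      rest.\<close>
    also have "(41 * real n * M + 1) * (8 * M + 3) \<le> (s / 2 + 1) * (s / 4 + 3)"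
    proof (intro mult_mono add_mono order_refl)
      show "41 * real n * M \<le> s / 2" "8 * M \<le> s / 4" unfolding mult.assoc using nM nM0 M0 by linarith+
    qed (use M0 s in auto)
    finally have "s * s \<le> real u0 + (s / 2 + 1) * (s / 4 + 3)" unfolding s_def by simp
    then have "7 * (s * s) \<le> 8 * real u0 + 14 * s + 24" by (simp add: field_simps)
    moreover have "(4 + real u0) * s \<le> s * s" using s by (intro mult_right_mono) auto
    moreover have "real u0 * 4 \<le> real u0 * s" using s by (intro mult_left_mono) auto
    ultimately show False using s by (simp add: algebra_simps)
  qed
  then show ?thesis unfolding eventually_sequentially by blast
qed

subsection \<open>The extremal point\<close>

definition gap :: real where "gap = real n + 1 - 2 * kappa n"
text \<open>For the first blocks the quotient may be negative; \<open>nat\<close> then gives 0, and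
  such blocks only raise the excess.\<close>

definition ones :: "nat \<Rightarrow> nat" where
  "ones k = nat \<lfloor>(real (Suc k) * gap - 10) / (kappa n - 1)\<rfloor>"
primrec pos :: "nat \<Rightarrow> nat" where
  "pos 0 = 0"
| "pos (Suc k) = pos k + 2 * Suc k + ones k"
definition blk :: "nat \<Rightarrow> nat" where "blk t = (LEAST k. t < pos (Suc k))"

text \<open>
  The \<open>k\<close>-th block is \<open>n, 1, n, 1, \<dots>, n, 1\<close> (\<open>k + 1\<close> pairs) followed by \<open>ones k\<close> digits \<open>1\<close>. Changing
  the regime costs a bounded factor per block, hence the digit sum must exceed \<open>kappa n * t\<close> by a
  multiple of the number of blocks, which \<open>ones k\<close> is chosen to provide (by about \<open>10\<close> per block).
\<close>
definition word :: "nat \<Rightarrow> nat" where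
  "word j = (let t = j - 1; i = t - pos (blk t) in if i < 2 * Suc (blk t) \<and> even i then n else 1)"

section \<open>Digit sums of the extremal word\<close>

lemma gap_ge: "1 / 4 \<le> gap"
  using kappa_less unfolding gap_def add_divide_distrib by linarith

lemma gap_le: "gap + (kappa n - 1) \<le> real n - 1" "gap \<le> real n - 1" "kappa n \<le> real n"
  using kappa_gt_1 gap_ge unfolding gap_def by linarith+

lemma pos_mono: "k \<le> l \<Longrightarrow> pos k \<le> pos l"
  by (rule lift_Suc_mono_le[of pos]) auto

lemma pos_ge: "k * k \<le> pos k"
  by (induction k) auto

lemma blk_pos:
  assumes "pos k \<le> t" "t < pos (Suc k)"
  shows "blk t = k"
  unfolding blk_def
proof (rule Least_equality)
  show "t < pos (Suc k)" by (rule assms(2))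
next
  fix l
  assume l: "t < pos (Suc l)"
  show "k \<le> l"
  proof (rule ccontr)
    assume "\<not> k \<le> l"
    then have "pos (Suc l) \<le> pos k" by (intro pos_mono) simp
    then show False using l assms(1) by simp
  qed
qed

lemma block_exists: "\<exists>k. pos k \<le> t \<and> t < pos (Suc k)"
proof -
  have ex: "t < pos (Suc t)" by simp
  then have up: "t < pos (Suc (blk t))" unfolding blk_def by (rule LeastI)
  have "pos (blk t) \<le> t"
  proof (cases "blk t")
    case (Suc l)
    then have "\<not> t < pos (Suc l)" using not_less_Least[of l "\<lambda>k. t < pos (Suc k)"] unfolding blk_def by simp
    then show ?thesis using Suc by simp
  qed simp
  with up show ?thesis by blast
qed

text \<open>\<open>pos k\<close> counts the digits before block \<open>k\<close>, and digits are
  numbered from 1, hence the \<open>Suc\<close>.\<close>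

lemma word_block:
  assumes "i < 2 * Suc k + ones k"
  shows "word (Suc (pos k + i)) = (if i < 2 * Suc k \<and> even i then n else 1)"
proof -
  have "blk (pos k + i) = k" using assms by (intro blk_pos) auto
  moreover have "Suc (pos k + i) - 1 = pos k + i" "pos k + i - pos k = i" by simp_all
  ultimately show ?thesis unfolding word_def Let_def by (simp only:)
qed

lemma word_digits: "digits word n"
  using n5 by (auto simp: digits_def word_def Let_def)

lemma excess_Suc: "excess a (Suc t) = excess a t + (real (a (Suc t)) - kappa n)"
  by (simp add: excess_def algebra_simps)

lemma excess_pairs:
  "i \<le> Suc k \<Longrightarrow> excess word (pos k + 2 * i) = excess word (pos k) + real i * gap"
proof (induction i)
  case (Suc i)
  have w: "word (Suc (pos k + 2 * i)) = n" "word (Suc (Suc (pos k + 2 * i))) = 1"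
    using word_block[of "2 * i" k] word_block[of "Suc (2 * i)" k] Suc.prems by simp_all
  have "excess word (pos k + 2 * Suc i) = excess word (pos k + 2 * i) + gap"
    by (simp add: excess_Suc w gap_def)
  then show ?case using Suc by (simp add: algebra_simps)
qed simp

lemma excess_ones:
  "i \<le> ones k \<Longrightarrow> excess word (pos k + 2 * Suc k + i) =
    excess word (pos k) + real (Suc k) * gap - real i * (kappa n - 1)"
proof (induction i)
  case 0
  show ?case using excess_pairs[of "Suc k" k] by (simp del: mult_Suc_right of_nat_Suc)
next
  case (Suc i)
  have w: "word (Suc (pos k + 2 * Suc k + i)) = 1"
    using word_block[of "2 * Suc k + i" k] Suc.prems by (simp add: add.assoc)
  have "excess word (pos k + 2 * Suc k + Suc i) = excess word (pos k + 2 * Suc k + i) + (1 - kappa n)"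
    using excess_Suc[of word "pos k + 2 * Suc k + i"] unfolding w by simp
  then show ?case using Suc by (simp add: algebra_simps)
qed

text \<open>Rounding the number of ones down leaves a surplus between 10 and
  \<open>10 + (kappa n - 1)\<close>, once the pairs yield at least 10; since
  \<open>gap \<ge> 1 / 4\<close>, 40 pairs are enough.\<close>

lemma excess_pos_step:
  shows "excess word (pos k) \<le> excess word (pos (Suc k))"
    and "39 \<le> k \<Longrightarrow> excess word (pos k) + 10 \<le> excess word (pos (Suc k))"
    and "excess word (pos (Suc k)) \<le> excess word (pos k) + (10 + (kappa n - 1))"
proof -
  define y where "y = real (Suc k) * gap"
  have d: "0 < kappa n - 1" using kappa_gt_1 by linarith
  have e: "excess word (pos (Suc k)) = excess word (pos k) + y - real (ones k) * (kappa n - 1)"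
    using excess_ones[of "ones k" k] by (simp add: y_def del: mult_Suc_right of_nat_Suc)
  have y0: "0 \<le> y" unfolding y_def using gap_ge by simp
  have "10 \<le> y - real (ones k) * (kappa n - 1) \<and> y - real (ones k) * (kappa n - 1) \<le> 10 + (kappa n - 1)"
    if "10 \<le> y"
  proof -
    have z: "0 \<le> (y - 10) / (kappa n - 1)" using that d by simp
    have "real (ones k) \<le> (y - 10) / (kappa n - 1)" "(y - 10) / (kappa n - 1) \<le> real (ones k) + 1"
      unfolding ones_def y_def[symmetric] using z by linarith+
    then have "real (ones k) * (kappa n - 1) \<le> y - 10" "y - 10 \<le> (real (ones k) + 1) * (kappa n - 1)"
      using d by (simp_all add: pos_le_divide_eq pos_divide_le_eq)
    then show ?thesis by (simp add: algebra_simps)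
  qed
  moreover have "ones k = 0" if "y < 10"
  proof -
    have "(y - 10) / (kappa n - 1) < 0" using that d by (simp add: divide_neg_pos)
    then show ?thesis unfolding ones_def y_def[symmetric] by linarith
  qed
  moreover have "10 \<le> y" if "39 \<le> k"
  proof -
    have "40 * (1 / 4) \<le> y" unfolding y_def using gap_ge that by (intro mult_mono) auto
    then show ?thesis by simp
  qed
  ultimately show "excess word (pos k) \<le> excess word (pos (Suc k))"
    "39 \<le> k \<Longrightarrow> excess word (pos k) + 10 \<le> excess word (pos (Suc k))"
    "excess word (pos (Suc k)) \<le> excess word (pos k) + (10 + (kappa n - 1))"
    unfolding e using y0 d by (cases "10 \<le> y"; force)+
qed

lemma excess_pos_bounds:
  "0 \<le> excess word (pos k)" "10 * real k - 400 \<le> excess word (pos k)"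
  "excess word (pos k) \<le> (10 + (kappa n - 1)) * real k"
proof -
  show nonneg: "0 \<le> excess word (pos k)" for k
  proof (induction k)
    case (Suc k)
    then show ?case using excess_pos_step(1)[of k] by linarith
  qed (simp add: excess_def)
  show "10 * real k - 400 \<le> excess word (pos k)"
  proof (induction k)
    case 0
    show ?case by (simp add: excess_def)
  next
    case (Suc k)
    show ?case
    proof (cases "39 \<le> k")
      case True
      then show ?thesis using Suc excess_pos_step(2)[OF True] by simp
    next
      case False
      then show ?thesis using nonneg[of "Suc k"] by (simp del: pos.simps)
    qed
  qed
  show "excess word (pos k) \<le> (10 + (kappa n - 1)) * real k"
  proof (induction k)
    case (Suc k)
    then show ?case using excess_pos_step(3)[of k] by (simp add: algebra_simps del: pos.simps)
  qed (simp add: excess_def)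
qed

lemma block_cases:
  assumes "pos k \<le> t" "t < pos (Suc k)"
  obtains i where "t = pos k + 2 * i" "i \<le> k"
  | i where "t = Suc (pos k + 2 * i)" "i \<le> k"
  | i where "t = pos k + 2 * Suc k + i" "i \<le> ones k"
proof -
  define j where "j = t - pos k"
  have j: "t = pos k + j" "j < 2 * Suc k + ones k" using assms by (simp_all add: j_def)
  show ?thesis
  proof (cases "j < 2 * Suc k")
    case True
    then have "j = 2 * (j div 2) \<or> j = Suc (2 * (j div 2))" "j div 2 \<le> k" by presburger+
    then show ?thesis using that(1,2) j(1) by (metis add_Suc_right)
  next
    case False
    then have "j = 2 * Suc k + (j - 2 * Suc k)" "j - 2 * Suc k \<le> ones k" using j(2) by linarith+
    then show ?thesis using that(3) j(1) by (metis add.assoc)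
  qed
qed

text \<open>Within a block the excess stays above its start during the pairs and above its final
  value during the ones; its peak is at most the start plus
  \<open>(k + 1) * gap + n\<close>.\<close>

lemma excess_block:
  assumes "pos k \<le> t" "t < pos (Suc k)"
  shows "10 * real k - 400 \<le> excess word t" "excess word t \<le> (real n + 9) * real k + 2 * real n"
proof -
  have d: "0 < kappa n - 1" and g: "0 < gap" using kappa_gt_1 gap_ge by linarith+
  have bounds: "excess word (pos k) \<le> excess word t \<or> excess word (pos (Suc k)) \<le> excess word t"
    "excess word t \<le> excess word (pos k) + (real (Suc k) * gap + real n)"
  proof -
    have ig: "0 \<le> real i * gap" "real i * gap \<le> real (Suc k) * gap" if "i \<le> k" for i
      using that g by (auto intro: mult_right_mono)
    have "(excess word (pos k) \<le> excess word t \<or> excess word (pos (Suc k)) \<le> excess word t) \<and>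
      excess word t \<le> excess word (pos k) + (real (Suc k) * gap + real n)"
      using assms
    proof (cases rule: block_cases)
      case (1 i)
      then show ?thesis using excess_pairs[of i k] ig[of i] by simp
    next
      case (2 i)
      have "word (Suc (pos k + 2 * i)) = n" using word_block[of "2 * i" k] 2 by simp
      then have "excess word t = excess word (pos k) + real i * gap + (real n - kappa n)"
        unfolding 2(1) excess_Suc using excess_pairs[of i k] 2 by simp
      then show ?thesis using ig[OF 2(2)] gap_le(3) d by linarith
    next
      case (3 i)
      have e: "excess word t = excess word (pos k) + real (Suc k) * gap - real i * (kappa n - 1)"
        unfolding 3(1) by (rule excess_ones[OF 3(2)])
      have "excess word (pos (Suc k)) = excess word (pos k) + real (Suc k) * gap - real (ones k) * (kappa n - 1)"
        using excess_ones[of "ones k" k] by (simp del: mult_Suc_right of_nat_Suc)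
      moreover have "real i * (kappa n - 1) \<le> real (ones k) * (kappa n - 1)" "0 \<le> real i * (kappa n - 1)"
        using d 3(2) by (auto intro: mult_right_mono)
      ultimately show ?thesis unfolding e by linarith
    qed
    then show "excess word (pos k) \<le> excess word t \<or> excess word (pos (Suc k)) \<le> excess word t"
      "excess word t \<le> excess word (pos k) + (real (Suc k) * gap + real n)" by blast+
  qed
  show "10 * real k - 400 \<le> excess word t"
    using bounds(1) excess_pos_bounds(2)[of k] excess_pos_bounds(2)[of "Suc k"] unfolding of_nat_Suc by fastforce
  have "real k * (gap + (kappa n - 1)) \<le> real k * (real n - 1)"
    by (rule mult_left_mono[OF gap_le(1)]) simp
  then show "excess word t \<le> (real n + 9) * real k + 2 * real n"
    using bounds(2) excess_pos_bounds(3)[of k] gap_le(2) by (simp add: algebra_simps)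
qed

text \<open>Block lengths grow linearly, so \<open>k * k \<le> t\<close>, while the excess is linear
  in \<open>k\<close>.\<close>

lemma excess_word_le:
  assumes "1 \<le> t"
  shows "excess word t \<le> 15 * real n * sqrt (real t)"
proof -
  obtain k where k: "pos k \<le> t" "t < pos (Suc k)" using block_exists by blast
  have "real (k * k) \<le> real t" using pos_ge[of k] k(1) by linarith
  then have kt: "real k \<le> sqrt (real t)" by (intro real_le_rsqrt) (simp add: power2_eq_square)
  have s1: "1 \<le> sqrt (real t)" using assms by simp
  have "excess word t \<le> (real n + 9) * real k + 2 * real n" by (rule excess_block(2)[OF k])
  also have "\<dots> \<le> (real n + 9) * sqrt (real t) + 2 * real n * sqrt (real t)"
    using kt s1 mult_left_mono[OF s1, of "2 * real n"] by (intro add_mono mult_left_mono) auto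
  also have "\<dots> = (3 * real n + 9) * sqrt (real t)" by (simp add: algebra_simps)
  also have "\<dots> \<le> 15 * real n * sqrt (real t)" using n_real s1 by (intro mult_right_mono) auto
  finally show ?thesis .
qed

section \<open>Denominators of the extremal word\<close>

definition lin :: "nat \<Rightarrow> real" where
  "lin t = ln gold * real t + beta * (real (digsum word t) - real t)"
text \<open>By homogeneity these are the three forms at the last two denominators;
  \<open>lin\<close> is the logarithm of the product of the weights, with which they are
  compared.\<close>

definition lfw :: "nat \<Rightarrow> real" where "lfw t = den word t * lf 1 (past word t)"
definition pfw :: "nat \<Rightarrow> real" where "pfw t = den word t * pf 1 (past word t)"
definition qfw :: "nat \<Rightarrow> real" where "qfw t = den word t * qf 1 (past word t)"

lemma form_Suc:
  "lfw (Suc t) = den word t * lf (real (word (Suc t)) + past word t) 1"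
  "pfw (Suc t) = den word t * pf (real (word (Suc t)) + past word t) 1"
  "qfw (Suc t) = den word t * qf (real (word (Suc t)) + past word t) 1"
proof -
  define z where "z = real (word (Suc t)) + past word t"
  have "0 < z" unfolding z_def
    using digitsD(3)[OF word_digits, of t] past_bounds(1)[OF word_digits, of t] by linarith
  then have "z * lf 1 (1 / z) = lf z 1" "z * pf 1 (1 / z) = pf z 1" "z * qf 1 (1 / z) = qf z 1"
    by (simp_all add: lf_def pf_def qf_def field_simps)
  then show "lfw (Suc t) = den word t * lf (real (word (Suc t)) + past word t) 1"
    "pfw (Suc t) = den word t * pf (real (word (Suc t)) + past word t) 1"
    "qfw (Suc t) = den word t * qf (real (word (Suc t)) + past word t) 1"
    unfolding lfw_def pfw_def qfw_def past.simps den.simps z_def[symmetric]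
    by (metis mult.assoc mult.commute)+
qed

text \<open>\<open>qfw / lfw\<close> lies between \<open>A * mu\<close> and
  \<open>gold * A * mu\<close>; the ratio of these bounds is what a change of regime and back can
  cost.\<close>

lemma form_bounds:
  "1 \<le> den word t" "qfw t \<le> gold * A * mu * lfw t" "lfw t * (A * mu) \<le> qfw t"
  "gold * A * mu * den word t \<le> qfw t" "0 < gold * A * mu"
proof -
  have x: "0 \<le> past word t" "past word t \<le> 1" using past_bounds[OF word_digits] by auto
  show dge: "1 \<le> den word t" by (rule den_mono_step(1)[OF word_digits])
  have Am: "0 \<le> gold * A" "0 < gold * A * mu" using gold_bounds A_bounds mu_bounds by auto
  have "(1 - mu) * past word t \<le> mu * ((gold - 1) * past word t)"
  proof -
    have "1 - mu \<le> 4 / 5 * (3 / 5)" using mu_bounds by simp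
    also have "\<dots> \<le> mu * (gold - 1)" using mu_bounds gold_bounds by (intro mult_mono) auto
    finally show ?thesis using mult_right_mono[of "1 - mu" "mu * (gold - 1)"] x by (simp add: mult.assoc)
  qed
  then have "qf 1 (past word t) \<le> gold * A * mu * lf 1 (past word t)"
    unfolding qf_def lf_def using mult_left_mono[OF _ Am(1), of "mu + (1 - mu) * past word t"
        "mu * (1 + (gold - 1) * past word t)"] by (simp add: algebra_simps)
  then show "qfw t \<le> gold * A * mu * lfw t"
    unfolding qfw_def lfw_def using mult_left_mono[of _ _ "den word t"] dge by (simp add: mult.left_commute)
  have q: "gold * A * mu \<le> qf 1 (past word t)"
  proof -
    have "gold * A * mu \<le> gold * A * (mu * 1 + (1 - mu) * past word t)"
      using x mu_bounds Am by (intro mult_left_mono) auto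
    then show ?thesis unfolding qf_def .
  qed
  then show "gold * A * mu * den word t \<le> qfw t"
    unfolding qfw_def using mult_left_mono[OF q, of "den word t"] dge by (simp add: mult.commute)
  have "lf 1 (past word t) \<le> gold" by (rule lf_le_gold[OF x(2)])
  then have "lf 1 (past word t) * (A * mu) \<le> gold * (A * mu)"
    using A_bounds mu_bounds by (intro mult_right_mono) auto
  with q have "lf 1 (past word t) * (A * mu) \<le> qf 1 (past word t)" by (simp add: mult.assoc)
  then show "lfw t * (A * mu) \<le> qfw t"
    unfolding qfw_def lfw_def using mult_left_mono[of _ _ "den word t"] dge by (simp add: mult.assoc)
  show "0 < gold * A * mu" by (rule Am(2))
qed

lemma qfw_pairs:
  "i \<le> Suc k \<Longrightarrow> ln (qfw (pos k + 2 * i)) - lin (pos k + 2 * i) = ln (qfw (pos k)) - lin (pos k)"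
proof (induction i)
  case (Suc i)
  let ?t = "pos k + 2 * i"
  have w: "word (Suc ?t) = n" "word (Suc (Suc ?t)) = 1"
    using word_block[of "2 * i" k] word_block[of "Suc (2 * i)" k] Suc.prems by simp_all
  have "qfw (Suc (Suc ?t)) = den word (Suc ?t) * (gold * pf 1 (past word (Suc ?t)))"
    unfolding form_Suc w of_nat_1 qf_one ..
  also have "\<dots> = gold * pfw (Suc ?t)" by (simp add: pfw_def)
  also have "pfw (Suc ?t) = den word ?t * (lam / gold * qf 1 (past word ?t))"
    unfolding form_Suc w using pf_n[of 1 "past word ?t"] by simp
  also have "gold * \<dots> = lam * qfw ?t" using gold_bounds by (simp add: qfw_def)
  finally have "qfw (Suc (Suc ?t)) = lam * qfw ?t" .
  moreover have "0 < qfw ?t" using form_bounds(1,4)[of ?t] form_bounds(5) mult_pos_pos[of "gold * A * mu" "den word ?t"] by linarith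
  ultimately have "ln (qfw (Suc (Suc ?t))) = ln lam + ln (qfw ?t)" using lam_bounds by (simp add: ln_mult)
  moreover have "lin (Suc (Suc ?t)) = lin ?t + ln lam"
    using beta_n unfolding lin_def digsum_simps w by (simp add: algebra_simps)
  ultimately show ?case using Suc by simp
qed simp

lemma lfw_ones:
  "i \<le> ones k \<Longrightarrow> ln (lfw (pos k + 2 * Suc k + i)) - lin (pos k + 2 * Suc k + i) =
    ln (lfw (pos k + 2 * Suc k)) - lin (pos k + 2 * Suc k)"
proof (induction i)
  case (Suc i)
  let ?t = "pos k + 2 * Suc k + i"
  have w: "word (Suc ?t) = 1"
    using word_block[of "2 * Suc k + i" k] Suc.prems by (simp add: add.assoc)
  have "lfw (Suc ?t) = gold * lfw ?t"
    unfolding form_Suc w of_nat_1 lf_one by (simp add: lfw_def)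
  moreover have "0 < lfw ?t"
    using form_bounds(1,2,4)[of ?t] form_bounds(5) mult_pos_pos[of "gold * A * mu" "den word ?t"]
    by (metis less_le_trans zero_less_mult_pos zero_less_one)
  ultimately have "ln (lfw (Suc ?t)) = ln gold + ln (lfw ?t)" using gold_bounds by (simp add: ln_mult)
  moreover have "lin (Suc ?t) = lin ?t + ln gold"
    unfolding lin_def digsum_simps w by (simp add: algebra_simps)
  ultimately show ?case using Suc by simp
qed simp

text \<open>Normalised to vanish at \<open>t = 0\<close>, where \<open>qfw\<close> is
  \<open>gold * A * mu\<close>.\<close>

definition dev :: "nat \<Rightarrow> real" where "dev t = ln (qfw t) - ln (gold * A * mu) - lin t"

lemma dev_bounds:
  "dev t \<le> ln (lfw t) - lin t" "ln (lfw t) - lin t \<le> dev t + ln gold" "ln (den word t) \<le> lin t + dev t"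
proof -
  note b = form_bounds(1-4)[of t] form_bounds(5)
  have g: "0 < gold" using gold_bounds by linarith
  have qp: "0 < qfw t" using b(1,4,5) mult_pos_pos[of "gold * A * mu" "den word t"] by linarith
  have lp: "0 < lfw t" using qp b(2,5) by (metis less_le_trans zero_less_mult_pos)
  have "ln (qfw t) \<le> ln (gold * A * mu * lfw t)" using qp b(2) by (intro ln_mono) auto
  also have "\<dots> = ln (gold * A * mu) + ln (lfw t)" using b(5) lp by (intro ln_mult_pos) auto
  finally show "dev t \<le> ln (lfw t) - lin t" unfolding dev_def by linarith
  have "gold * A * mu * lfw t \<le> gold * qfw t" using mult_left_mono[OF b(3), of gold] g by (simp add: ac_simps)
  then have "ln (gold * A * mu * lfw t) \<le> ln (gold * qfw t)" using b(5) lp g qp by (intro ln_mono) auto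
  moreover have "ln (gold * A * mu * lfw t) = ln (gold * A * mu) + ln (lfw t)"
    using b(5) lp by (intro ln_mult_pos) auto
  moreover have "ln (gold * qfw t) = ln gold + ln (qfw t)" using g qp by (intro ln_mult_pos) auto
  ultimately show "ln (lfw t) - lin t \<le> dev t + ln gold" unfolding dev_def by linarith
  have "ln (gold * A * mu * den word t) \<le> ln (qfw t)" using b by (intro ln_mono mult_pos_pos[OF b(5)]) auto
  moreover have "ln (gold * A * mu * den word t) = ln (gold * A * mu) + ln (den word t)"
    using b(1,5) by (intro ln_mult_pos) auto
  ultimately show "ln (den word t) \<le> lin t + dev t" unfolding dev_def by linarith
qed

text \<open>The pairs preserve \<open>dev\<close>, the ones preserve the analogue with
  \<open>lfw\<close>. Passing from \<open>qfw\<close> to \<open>lfw\<close> costs at most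
  \<open>ln gold\<close>, and passing back costs nothing.\<close>

lemma dev_ones:
  assumes "i \<le> ones k"
  shows "dev (pos k + 2 * Suc k + i) \<le> dev (pos k) + ln gold"
proof -
  have "dev (pos k + 2 * Suc k) = dev (pos k)" using qfw_pairs[of "Suc k" k] unfolding dev_def by linarith
  then show ?thesis
    using dev_bounds(1)[of "pos k + 2 * Suc k + i"] dev_bounds(2)[of "pos k + 2 * Suc k"] lfw_ones[OF assms]
    by linarith
qed

lemma dev_pos: "dev (pos k) \<le> real k * ln gold"
proof (induction k)
  case 0
  show ?case by (simp add: dev_def qfw_def qf_def lin_def)
next
  case (Suc k)
  then show ?case using dev_ones[of "ones k" k] by (simp add: algebra_simps)
qed

lemma ln_den_block:
  assumes "pos k \<le> t" "t < pos (Suc k)"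
  shows "ln (den word t) \<le> lin t + (real k + 1) * ln gold + ln (real n + 1)"
proof -
  have N: "0 \<le> ln (real n + 1)" by (rule ln_ge_zero) simp
  note g = ln_gold_pos
  have pairs: "ln (den word (pos k + 2 * i)) \<le> lin (pos k + 2 * i) + real k * ln gold" if "i \<le> k" for i
    using dev_bounds(3)[of "pos k + 2 * i"] qfw_pairs[of i k] dev_pos[of k] that unfolding dev_def by simp
  show ?thesis
    using assms
  proof (cases rule: block_cases)
    case (1 i)
    then show ?thesis using pairs[OF 1(2)] N g unfolding 1(1) distrib_right by linarith
  next
    case (2 i)
    let ?s = "pos k + 2 * i"
    have x: "0 \<le> past word ?s" "past word ?s \<le> 1" using past_bounds[OF word_digits] by auto
    have dpos: "1 \<le> den word ?s" by (rule form_bounds(1))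
    \<comment> \<open>Inside a pair the exact relation for \<open>qfw\<close> is interrupted; a
      single step costs at most the factor \<open>n + 1\<close>.\<close>
    have "den word (Suc ?s) \<le> (real n + 1) * den word ?s"
      unfolding den.simps using digitsD(4)[OF word_digits, of ?s] x dpos by (intro mult_right_mono) auto
    moreover have "1 \<le> den word (Suc ?s)" by (rule form_bounds(1))
    ultimately have "ln (den word (Suc ?s)) \<le> ln ((real n + 1) * den word ?s)" by (intro ln_mono) auto
    also have "\<dots> = ln (real n + 1) + ln (den word ?s)" using dpos by (intro ln_mult_pos) auto
    finally have "ln (den word (Suc ?s)) \<le> ln (real n + 1) + (lin ?s + real k * ln gold)"
      using pairs[OF 2(2)] by linarith
    moreover have "lin ?s \<le> lin (Suc ?s)"
    proof -
      have "lin (Suc ?s) = lin ?s + (ln gold + beta * (real (word (Suc ?s)) - 1))"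
        unfolding lin_def digsum_simps by (simp add: algebra_simps)
      moreover have "0 \<le> beta * (real (word (Suc ?s)) - 1)"
        using beta_nonneg digitsD(3)[OF word_digits, of ?s] by (intro mult_nonneg_nonneg) auto
      ultimately show ?thesis using g by linarith
    qed
    ultimately show ?thesis unfolding 2(1) distrib_right using g by linarith
  next
    case (3 i)
    then show ?thesis
      using dev_ones[OF 3(2)] dev_pos[of k] dev_bounds(3)[of t] N unfolding distrib_right 3(1) by linarith
  qed
qed

text \<open>In block \<open>k\<close> the excess contributes at least \<open>k / 2 - 20\<close>,
  against a loss of \<open>(k + 1) * ln gold + ln (n + 1)\<close>; \<open>ln gold < 1 / 2\<close>
  decides.\<close>

lemma word_deriv_criterion: "(\<lambda>t. (den word t)\<^sup>2 / 2 ^ digsum word t) \<longlonglongrightarrow> 0"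
proof (rule LIMSEQ_I)
  fix e :: real
  assume e: "0 < e"
  define C where "C = 2 * (ln gold + ln (real n + 1) + 20)"
  have h: "0 < 2 * (1 / 2 - ln gold)" using ln_gold_less by simp
  obtain K :: nat where K: "(C - ln e) / (2 * (1 / 2 - ln gold)) < real K" using reals_Archimedean2 by blast
  have "norm ((den word t)\<^sup>2 / 2 ^ digsum word t - 0) < e" if t: "pos (max K 40) \<le> t" for t
  proof -
    obtain k where k: "pos k \<le> t" "t < pos (Suc k)" using block_exists by blast
    have kK: "max K 40 \<le> k"
    proof (rule ccontr)
      assume "\<not> ?thesis"
      then have "pos (Suc k) \<le> pos (max K 40)" by (intro pos_mono) linarith
      then show False using k t by simp
    qed
    have dpos: "0 < den word t" using form_bounds(1)[of t] by linarith
    have "gam * (10 * real k - 400) \<le> gam * excess word t"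
      using excess_block(1)[OF k] gam_bounds by (intro mult_left_mono) auto
    \<comment> \<open>\<open>k \<ge> 40\<close> makes the second factor nonnegative.\<close>
    moreover have "1 / 20 * (10 * real k - 400) \<le> gam * (10 * real k - 400)"
      using gam_bounds kK by (intro mult_right_mono) auto
    moreover have "gam * excess word t = real (digsum word t) * ln (sqrt 2) - lin t"
      unfolding gam_excess lin_def ..
    ultimately have "real k / 2 - 20 \<le> real (digsum word t) * ln 2 / 2 - lin t"
      unfolding ln_sqrt_2 by simp
    then have "2 * ln (den word t) - real (digsum word t) * ln 2 \<le> C - 2 * (1 / 2 - ln gold) * real k"
      using ln_den_block[OF k] unfolding C_def by (simp add: algebra_simps)
    also have "\<dots> < ln e"
    proof -
      have "(C - ln e) / (2 * (1 / 2 - ln gold)) < real k" using K kK by simp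
      then have "C - ln e < real k * (2 * (1 / 2 - ln gold))" unfolding pos_divide_less_eq[OF h] .
      then show ?thesis unfolding mult.commute[of _ "real k"] by linarith
    qed
    also have "2 * ln (den word t) - real (digsum word t) * ln 2 = ln ((den word t)\<^sup>2 / 2 ^ digsum word t)"
      using dpos by (simp add: ln_div ln_realpow)
    finally have "(den word t)\<^sup>2 / 2 ^ digsum word t < e" using e dpos by simp
    then show ?thesis using dpos by simp
  qed
  then show "\<exists>N. \<forall>t\<ge>N. norm ((den word t)\<^sup>2 / 2 ^ digsum word t - 0) < e" by blast
qed

lemma extremal_point:
  "\<exists>x\<in>E n. (question_mark has_real_derivative 0) (at x) \<and>
    (\<forall>\<^sub>F t in sequentially. real (S x t) - kappa n * real t \<le> 15 * real n * sqrt (real t))"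
proof -
  obtain x where x: "x \<in> E n" "\<And>j. 1 \<le> j \<Longrightarrow> pquot x j = word j"
    using E_prescribed[OF word_digits] by blast
  have S: "S x t = digsum word t" for t
    unfolding S_eq_digsum digsum_def using x(2) by (intro sum.cong) auto
  have past: "past (pquot x) t = past word t" for t by (induction t) (simp_all add: x(2))
  have den: "den (pquot x) t = den word t" for t by (induction t) (simp_all add: x(2) past)
  have "(question_mark has_real_derivative 0) (at x)"
    by (rule question_mark_deriv_zeroI[OF x(1)]) (simp only: den S word_deriv_criterion)
  moreover have "\<forall>\<^sub>F t in sequentially. real (S x t) - kappa n * real t \<le> 15 * real n * sqrt (real t)"
    unfolding eventually_sequentially using excess_word_le by (auto simp: S excess_def)
  ultimately show ?thesis using x(1) by blast
qed

end

theorem theorem6: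
  fixes n :: nat
  assumes "n \<ge> 5"
  shows "(\<forall>x \<in> E n. (question_mark has_real_derivative 0) (at x) \<longrightarrow>
           (\<forall>\<^sub>F t in sequentially.
              Max ((\<lambda>u. real (S x u) - kappa n * real u) ` {1..t})
                \<ge> sqrt (real t) / (160 * (real n + 2) ^ 10))) \<and>
         (\<exists>x \<in> E n. (question_mark has_real_derivative 0) (at x) \<and>
           (\<forall>\<^sub>F t in sequentially.
              real (S x t) - kappa n * real t \<le> 15 * real n * sqrt (real t)))"
proof -
  interpret digit_bound n using assms by unfold_locales
  show ?thesis using max_excess_ge extremal_point by blast
qed

end
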